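(* Let $\beta>0$ and $f_{\pm}(x)=\dfrac{1}{e^{\beta x}\pm1}$, and let $T_{f_\pm}$ be the tempered distributions generated by $f_\pm$ (via Hadamard finite part at $x=0$ where needed), whose Fourier transforms are $$\mathscr{F}T_{f_{\pm}}[\varphi]=\mathrm{f.p.\ of}\lim_{\epsilon\to0^{+}}\int_{|x|>\epsilon}\frac{\hat{\varphi}(x)}{e^{\beta x}\pm1}\,dx .$$ Then $$\mathscr{F}T_{f_{+}}=\pi\delta+T_{g},\qquad \mathscr{F}T_{f_{-}}=-\pi\delta+T_{h},$$ where $$g(x)=\frac{i\pi}{\beta\sinh\frac{\pi x}{\beta}},\qquad h(x)=\frac{\pi}{i\beta}\coth\frac{\pi x }{\beta},$$ and $T_g,T_h$ denote the distributions generated by $g,h$ (with the singularity at $x=0$ taken in the principal value / finite part sense).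
   Context: Fourier transform convention: $\hat{\varphi}(k)=\int_{\mathbb{R}}\varphi(x)e^{-ikx}\,dx$ for Schwartz functions $\varphi$, and $\mathscr{F}T[\varphi]:=T[\hat\varphi]$ for tempered distributions $T$. $\delta[\varphi]=\varphi(0)$. "f.p. of" (Hadamard finite part) means the constant term remaining after discarding the terms that diverge as $\epsilon\to0^+$. *)

theory Defs
  imports "HOL-Analysis.Analysis"
begin

definition nth_deriv :: "nat \<Rightarrow> (real \<Rightarrow> complex) \<Rightarrow> real \<Rightarrow> complex" where
  "nth_deriv n f = ((\<lambda>g x. vector_derivative g (at x)) ^^ n) f"

definition schwartz :: "(real \<Rightarrow> complex) \<Rightarrow> bool" where
  "schwartz \<phi> \<longleftrightarrow>
     (\<forall>n x. nth_deriv n \<phi> differentiable (at x)) \<and>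
     (\<forall>m n. \<exists>C. \<forall>x. norm (of_real (x ^ m) * nth_deriv n \<phi> x) \<le> C)"

definition fourier :: "(real \<Rightarrow> complex) \<Rightarrow> real \<Rightarrow> complex" where
  "fourier \<phi> k = (LINT x|lborel. \<phi> x * exp (- (\<i> * of_real (k * x))))"

definition has_finite_part :: "(real \<Rightarrow> complex) \<Rightarrow> complex \<Rightarrow> bool" where
  "has_finite_part F c \<longleftrightarrow>
     (\<exists>A (a :: real \<Rightarrow> complex) (b :: complex). finite A \<and> A \<subseteq> {0<..} \<and>
        ((\<lambda>\<epsilon>. F \<epsilon> - (\<Sum>l\<in>A. a l * of_real (\<epsilon> powr (- l))) - b * of_real (ln \<epsilon>))
           \<longlongrightarrow> c) (at_right 0))"

text \<open>The (finite-part / principal-value) distribution generated by f takes the value c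
  on the test function phi: c = f.p. of lim_{eps->0+} int_{|x|>eps} f(x) phi(x) dx.\<close>
definition fp_pairing :: "(real \<Rightarrow> complex) \<Rightarrow> (real \<Rightarrow> complex) \<Rightarrow> complex \<Rightarrow> bool" where
  "fp_pairing f \<phi> c \<longleftrightarrow>
     has_finite_part (\<lambda>\<epsilon>. LINT x:{x. \<epsilon> < \<bar>x\<bar>}|lborel. f x * \<phi> x) c"

end

theory Submission
  imports Defs "HOL-Probability.Sinc_Integral"
begin

text \<open>
  Since 1/(e^t + 1) = 1/(e^t - 1) - 2/(e^(2t) - 1) and 1/sinh(2z) = coth z - coth(2z), the
  statement for f_+ is the one for f_- at beta minus twice the one at 2 beta, so only f_- matters.
  All finite parts are genuine principal values. Write H for the Fourier transform of phi,
  D(x) = H(x) - H(-x) and psi(y) = phi(y) - phi(-y). Folding the integral onto x > 0 leaves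
  the integral of D(x)/(e^(beta x) - 1) - H(-x). Expand the first term into the geometric series
  of e^(-n beta x); by Fubini the n-th term contributes -2i times the integral of
  y psi(y)/(y^2 + n^2 beta^2), and the partial fraction expansion of coth, obtained here from the
  reflection formula of the Digamma function, sums the series. Abel summation gives the integral of
  H(-x) as pi phi(0) plus i times the integral of psi(y)/y; the latter cancels against the polar
  part of coth.
\<close>

subsection \<open>Principal values and the partial fractions of coth\<close>

text \<open>Near 0 the Bose function behaves like 1/(\<beta>x). Against H itself the n-th term of
  the geometric series would integrate to about H(0)/(n\<beta>), so the series would diverge
  whenever H(0) is not 0. Pairing x with -x replaces H by D, which is O(x) at 0; then every exchange
  of limit and integral has an absolutely integrable majorant. On the other side, \<psi> plays the
  same part for 1/y and for coth. The Bose function is not odd: f(-x) = -1 - f(x). The constant -1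
  leaves the term -H(-x), and that term alone produces the delta. The integral of e^(ixy) over x > 0
  does not converge, so the factor e^(-ax) is inserted before Fubini and removed afterwards by a ->
  0. In the Fermi case the delta coefficient becomes -pi - 2(-pi) = pi, and the poles of the two
  Bose functions cancel.\<close>

lemma
  shows integrable_inverse_1_plus_square': "integrable lborel (\<lambda>x::real. 1 / (1 + x\<^sup>2))"
    and integral_inverse_1_plus_square': "(LINT x|lborel. 1 / (1 + x\<^sup>2)) = pi"
  using integrable_inverse_1_plus_square LBINT_inverse_1_plus_square
  by (simp_all add: interval_lebesgue_integral_def set_integrable_def set_lebesgue_integral_def
      einterval_def divide_inverse)

lemma integrable_quadratic_decay:
  fixes f :: "real \<Rightarrow> 'a :: {banach,second_countable_topology}"
  assumes "f \<in> borel_measurable borel" and "\<And>x. norm (f x) \<le> C / (1 + x\<^sup>2)"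
  shows "integrable lborel f"
proof (rule Bochner_Integration.integrable_bound)
  show "integrable lborel (\<lambda>x. C * (1 / (1 + x\<^sup>2)))"
    by (intro integrable_mult_right integrable_inverse_1_plus_square')
  show "AE x in lborel. norm (f x) \<le> norm (C * (1 / (1 + x\<^sup>2)))"
    using assms(2) by (intro AE_I2) (metis abs_ge_self mult.right_neutral order_trans real_norm_def times_divide_eq_right)
qed (use assms in auto)

section \<open>Folding integrals onto the positive half-line\<close>

lemma set_integral_reflect:
  fixes F :: "real \<Rightarrow> 'a :: {banach,second_countable_topology}"
  shows "(LINT x:uminus ` A|lborel. F x) = (LINT x:A|lborel. F (- x))"
    and "set_integrable lborel (uminus ` A) F \<longleftrightarrow> set_integrable lborel A (\<lambda>x. F (- x))"
proof -
  have ind: "indicator (uminus ` A) (- x) = (indicator A x :: real)" for x :: real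
    by (auto split: split_indicator)
  show "(LINT x:uminus ` A|lborel. F x) = (LINT x:A|lborel. F (- x))"
    using lborel_integral_real_affine[of "-1" "\<lambda>x. indicator (uminus ` A) x *\<^sub>R F x" 0]
    by (simp add: set_lebesgue_integral_def ind)
  show "set_integrable lborel (uminus ` A) F \<longleftrightarrow> set_integrable lborel A (\<lambda>x. F (- x))"
    using lborel_integrable_real_affine_iff[of "-1" "\<lambda>x. indicator (uminus ` A) x *\<^sub>R F x" 0]
    by (simp add: set_integrable_def ind)
qed

lemma set_integral_fold:
  fixes F :: "real \<Rightarrow> complex"
  assumes e: "\<epsilon> \<ge> 0" and F: "set_integrable lborel {x. \<epsilon> < \<bar>x\<bar>} F"
  shows "(LINT x:{x. \<epsilon> < \<bar>x\<bar>}|lborel. F x) = (LINT x:{\<epsilon><..}|lborel. F x + F (- x))"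
proof -
  have split: "{x. \<epsilon> < \<bar>x\<bar>} = {\<epsilon><..} \<union> uminus ` {\<epsilon><..}"
    using e by (auto simp: abs_if)
  have neg: "uminus ` {\<epsilon><..} = {..<-\<epsilon>}" by simp
  have p: "set_integrable lborel {\<epsilon><..} F" "set_integrable lborel (uminus ` {\<epsilon><..}) F"
    unfolding neg using e by (auto intro!: set_integrable_subset[OF F])
  then have m: "set_integrable lborel {\<epsilon><..} (\<lambda>x. F (- x))"
    by (subst (asm) set_integral_reflect)
  have "(LINT x:{x. \<epsilon> < \<bar>x\<bar>}|lborel. F x)
      = (LINT x:{\<epsilon><..}|lborel. F x) + (LINT x:uminus ` {\<epsilon><..}|lborel. F x)"
    unfolding split using p e by (intro set_integral_Un) auto
  also have "\<dots> = (LINT x:{\<epsilon><..}|lborel. F x + F (- x))"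
    by (subst set_integral_reflect) (simp add: set_integral_add(2)[OF p(1) m])
  finally show "(LINT x:{x. \<epsilon> < \<bar>x\<bar>}|lborel. F x) = (LINT x:{\<epsilon><..}|lborel. F x + F (- x))" .
qed

lemma integral_fold:
  fixes F :: "real \<Rightarrow> complex"
  assumes "integrable lborel F"
  shows "(LINT x|lborel. F x) = (LINT x:{0<..}|lborel. F x + F (- x))"
proof -
  have "set_integrable lborel {x. 0 < \<bar>x\<bar>} F"
    unfolding set_integrable_def using assms by (intro integrable_mult_indicator) auto
  moreover have "(LINT x|lborel. F x) = (LINT x:{x. 0 < \<bar>x\<bar>}|lborel. F x)"
    unfolding set_lebesgue_integral_def
    by (rule integral_discrete_difference[where X = "{0}"]) auto
  ultimately show ?thesis
    by (simp only: set_integral_fold[OF order_refl])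
qed

lemma tendsto_set_integral_Ioi_at_right:
  fixes G :: "real \<Rightarrow> complex"
  assumes G: "set_integrable lborel {0<..} G"
  shows "((\<lambda>\<epsilon>. LINT x:{\<epsilon><..}|lborel. G x) \<longlongrightarrow> (LINT x:{0<..}|lborel. G x)) (at_right 0)"
proof (rule tendsto_at_right_sequentially[of 0 1])
  fix S :: "nat \<Rightarrow> real"
  assume S: "\<And>n. 0 < S n" "decseq S" "S \<longlonglongrightarrow> 0"
  have eq: "{0<..} = (\<Union>n. {S n<..})"
  proof (intro equalityI subsetI)
    fix x :: real assume "x \<in> {0<..}"
    then have "eventually (\<lambda>n. S n < x) sequentially"
      using order_tendstoD(2)[OF S(3)] by auto
    then show "x \<in> (\<Union>n. {S n<..})"
      by (auto simp: eventually_sequentially)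
  next
    fix x assume "x \<in> (\<Union>n. {S n<..})"
    then obtain n where "S n < x" by auto
    with S(1)[of n] show "x \<in> {0<..}" by simp
  qed
  show "(\<lambda>n. LINT x:{S n<..}|lborel. G x) \<longlonglongrightarrow> (LINT x:{0<..}|lborel. G x)"
    unfolding eq using S(2) G unfolding eq
    by (intro set_integral_cont_up) (auto simp: incseq_def decseq_def intro: order_le_less_trans)
qed simp

text \<open>An odd pole of \<open>F\<close> at 0 cancels in \<open>F x + F (- x)\<close>. Thus
  integrability of the symmetric sum yields the limit even when \<open>F\<close> itself is not
  integrable near 0.\<close>

lemma tendsto_principal_value:
  fixes F :: "real \<Rightarrow> complex"
  assumes "\<And>\<epsilon>. \<epsilon> > 0 \<Longrightarrow> set_integrable lborel {x. \<epsilon> < \<bar>x\<bar>} F"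
    and "set_integrable lborel {0<..} (\<lambda>x. F x + F (- x))"
  shows "((\<lambda>\<epsilon>. LINT x:{x. \<epsilon> < \<bar>x\<bar>}|lborel. F x) \<longlongrightarrow> (LINT x:{0<..}|lborel. F x + F (- x)))
           (at_right 0)"
proof -
  have "eventually (\<lambda>\<epsilon>. (LINT x:{\<epsilon><..}|lborel. F x + F (- x))
      = (LINT x:{x. \<epsilon> < \<bar>x\<bar>}|lborel. F x)) (at_right 0)"
    using assms(1) by (auto simp: eventually_at_filter set_integral_fold)
  with tendsto_set_integral_Ioi_at_right[OF assms(2)] show ?thesis
    by (rule Lim_transform_eventually)
qed

section \<open>Reflection formula and pole expansion of coth\<close>

text \<open>This is the logarithmic derivative of the reflection formula. Working with
  \<open>rGamma\<close> keeps both factors entire; the signs come from \<open>Digamma\<close> being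
  minus the logarithmic derivative of \<open>rGamma\<close>.\<close>

lemma Digamma_reflection:
  fixes z :: complex
  assumes "z \<notin> \<int>"
  shows "Digamma (1 - z) - Digamma z = of_real pi * cot (of_real pi * z)"
proof -
  have nz: "z \<notin> \<int>\<^sub>\<le>\<^sub>0" "1 - z \<notin> \<int>\<^sub>\<le>\<^sub>0"
    using assms nonpos_Ints_Int Ints_diff[OF Ints_1, of "1 - z"] by auto
  have refl: "(\<lambda>w::complex. rGamma w * rGamma (1 - w)) = (\<lambda>w. sin (of_real pi * w) / of_real pi)"
    using rGamma_reflection_complex by auto
  have "((\<lambda>w. rGamma w * rGamma (1 - w)) has_field_derivative
      rGamma z * rGamma (1 - z) * (Digamma (1 - z) - Digamma z)) (at z)"
    using nz by (auto intro!: derivative_eq_intros simp: algebra_simps)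
  moreover have "((\<lambda>w. sin (of_real pi * w) / of_real pi) has_field_derivative cos (of_real pi * z)) (at z)"
    by (auto intro!: derivative_eq_intros)
  ultimately have "rGamma z * rGamma (1 - z) * (Digamma (1 - z) - Digamma z) = cos (of_real pi * z)"
    unfolding refl by (rule DERIV_unique)
  then have *: "sin (of_real pi * z) * (Digamma (1 - z) - Digamma z) = of_real pi * cos (of_real pi * z)"
    using fun_cong[OF refl, of z] by (simp add: field_simps)
  \<comment> \<open>\<open>rGamma\<close> vanishes exactly at the non-positive integers, which
    \<open>z\<close> and \<open>1 - z\<close> both avoid.\<close>
  have "sin (of_real pi * z) \<noteq> 0"
    using nz fun_cong[OF refl, of z] by (auto simp: rGamma_eq_zero_iff)
  with * show ?thesis
    by (simp add: cot_def field_simps)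
qed

text \<open>With z = i\<tau>, the Digamma series at 1 + z and 1 - z share their harmonic terms and
  the Euler constant. Their difference combines the poles at n and -n into 2z/(n^2 - z^2).
  Reflection evaluates the sum, and 1/z comes from shifting the argument 1 + z to z.\<close>

lemma coth_partial_fractions:
  fixes \<tau> :: real
  assumes "\<tau> > 0"
  shows "(\<lambda>k. 2 * \<tau> / (\<tau>\<^sup>2 + (real (Suc k))\<^sup>2)) sums (pi * cosh (pi * \<tau>) / sinh (pi * \<tau>) - 1 / \<tau>)"
proof -
  define z where "z = \<i> * complex_of_real \<tau>"
  have zZ: "z \<notin> \<int>"
    using assms by (auto simp: z_def complex_is_Int_iff)
  have z0: "z \<noteq> 0" "1 + z \<noteq> 0" "1 - z \<noteq> 0"
    using assms by (auto simp: z_def complex_eq_iff)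
  have "(\<lambda>k. (inverse (of_nat (Suc k)) - inverse (1 + z + of_nat k))
           - (inverse (of_nat (Suc k)) - inverse (1 - z + of_nat k)))
        sums ((Digamma (1 + z) + euler_mascheroni) - (Digamma (1 - z) + euler_mascheroni))"
    using summable_Digamma[OF z0(2)] summable_Digamma[OF z0(3)]
    by (intro sums_diff) (simp_all add: Digamma_def summable_sums)
  also have "(\<lambda>k. (inverse (of_nat (Suc k)) - inverse (1 + z + of_nat k))
           - (inverse (of_nat (Suc k)) - inverse (1 - z + of_nat k)))
      = (\<lambda>k. \<i> * of_real (2 * \<tau> / (\<tau>\<^sup>2 + (real (Suc k))\<^sup>2)))"
  proof
    fix k
    define n where "n = real (Suc k)"
    have "n > 0" by (simp add: n_def)
    have ne: "complex_of_real n + z \<noteq> 0" "complex_of_real n - z \<noteq> 0" "complex_of_real (\<tau>\<^sup>2 + n\<^sup>2) \<noteq> 0"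
      using \<open>n > 0\<close> by (auto simp: z_def complex_eq_iff simp del: of_real_add of_real_power)
    have prod: "(complex_of_real n + z) * (complex_of_real n - z) = complex_of_real (\<tau>\<^sup>2 + n\<^sup>2)"
      by (simp add: z_def algebra_simps power2_eq_square)
    have "(inverse (of_nat (Suc k)) - inverse (1 + z + of_nat k))
           - (inverse (of_nat (Suc k)) - inverse (1 - z + of_nat k))
        = inverse (of_real n - z) - inverse (of_real n + z)"
      by (simp add: n_def algebra_simps)
    also have "\<dots> = 2 * z / ((of_real n + z) * (of_real n - z))"
      using ne by (simp add: field_simps)
    also have "\<dots> = \<i> * of_real (2 * \<tau> / (\<tau>\<^sup>2 + n\<^sup>2))"
      unfolding prod by (simp add: z_def)
    finally show "(inverse (of_nat (Suc k)) - inverse (1 + z + of_nat k))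
           - (inverse (of_nat (Suc k)) - inverse (1 - z + of_nat k))
        = \<i> * of_real (2 * \<tau> / (\<tau>\<^sup>2 + (real (Suc k))\<^sup>2))"
      unfolding n_def .
  qed
  also have "(Digamma (1 + z) + euler_mascheroni) - (Digamma (1 - z) + euler_mascheroni)
      = 1 / z - (Digamma (1 - z) - Digamma z)"
    using Digamma_plus1[OF z0(1)] by (simp add: algebra_simps)
  also have "\<dots> = 1 / z - of_real pi * cot (of_real pi * z)"
    by (simp add: Digamma_reflection[OF zZ])
  also have "\<dots> = \<i> * of_real (pi * cosh (pi * \<tau>) / sinh (pi * \<tau>) - 1 / \<tau>)"
  proof -
    have a: "of_real pi * z = \<i> * of_real (pi * \<tau>)" by (simp add: z_def)
    have sin: "sin (\<i> * complex_of_real x) = \<i> * of_real (sinh x)" for x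
    proof -
      have "complex_of_real (sinh x) = sinh (of_real x)"
        by (simp add: sinh_def scaleR_conv_of_real flip: exp_of_real)
      then show ?thesis by (simp add: sinh_conv_sin)
    qed
    have cos: "cos (\<i> * complex_of_real x) = of_real (cosh x)" for x
    proof -
      have "complex_of_real (cosh x) = cosh (of_real x)"
        by (simp add: cosh_def scaleR_conv_of_real flip: exp_of_real)
      then show ?thesis by (simp add: cosh_conv_cos)
    qed
    have "cot (of_real pi * z) = - \<i> * of_real (cosh (pi * \<tau>) / sinh (pi * \<tau>))"
      unfolding a cot_def sin cos by (simp add: divide_simps mult.commute)
    then show ?thesis
      using assms by (simp add: z_def field_simps)
  qed
  \<comment> \<open>Both sides carry a factor i; multiplying by -i brings the identity down to a
    real series.\<close>
  finally have "(\<lambda>k. (- \<i>) * (\<i> * of_real (2 * \<tau> / (\<tau>\<^sup>2 + (real (Suc k))\<^sup>2))))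
      sums ((- \<i>) * (\<i> * of_real (pi * cosh (pi * \<tau>) / sinh (pi * \<tau>) - 1 / \<tau>)))"
    by (rule sums_mult)
  then show ?thesis
    by (simp only: sums_of_real_iff mult.assoc[symmetric] i_squared minus_minus mult_minus_left mult_1_left)
qed

subsection \<open>The Fourier transform of Schwartz functions\<close>

lemma set_integral_exp_Ioi:
  fixes c :: complex
  assumes c: "Re c > 0"
  shows "(LINT x:{0<..}|lborel. exp (- (c * of_real x))) = 1 / c"
proof -
  have int: "set_integrable lborel {0<..} (\<lambda>x::real. exp (- (c * of_real x)))"
    by (rule set_integrable_bound[OF integrable_I0i_exp_mscale[OF c]])
       (auto simp: set_borel_measurable_def mult.commute)
  have c0: "c \<noteq> 0" using c by auto
  have "(LBINT x=0..\<infinity>. exp (- (c * of_real x))) = 0 - (- 1 / c)"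
  proof (rule interval_integral_FTC_integrable[where F = "\<lambda>x. - exp (- (c * of_real x)) / c"])
    show "((\<lambda>x. - exp (- (c * of_real x)) / c) has_vector_derivative exp (- (c * of_real x))) (at x)" for x
      using c0 by (auto intro!: derivative_eq_intros has_vector_derivative_real_field)
    show "set_integrable lborel (einterval 0 \<infinity>) (\<lambda>x. exp (- (c * of_real x)))"
      using int by (simp add: zero_ereal_def)
    show "(((\<lambda>x. - exp (- (c * of_real x)) / c) \<circ> real_of_ereal) \<longlongrightarrow> - 1 / c) (at_right 0)"
      unfolding zero_ereal_def ereal_tendsto_simps using c0 by (auto intro!: tendsto_eq_intros)
    have "((\<lambda>x. exp (- (Re c * x))) \<longlongrightarrow> 0) at_top"
      using c by (auto intro!: exp_at_bot[THEN filterlim_compose] filterlim_tendsto_pos_mult_at_top filterlim_ident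
             simp: filterlim_uminus_at_bot)
    then have "((\<lambda>x. exp (- (c * of_real x))) \<longlongrightarrow> 0) at_top"
      by - (rule tendsto_norm_zero_cancel, simp)
    from tendsto_divide[OF tendsto_minus[OF this] tendsto_const c0]
    show "(((\<lambda>x. - exp (- (c * of_real x)) / c) \<circ> real_of_ereal) \<longlongrightarrow> 0) (at_left \<infinity>)"
      unfolding ereal_tendsto_simps by simp
  qed (auto intro!: continuous_intros)
  then show "(LINT x:{0<..}|lborel. exp (- (c * of_real x))) = 1 / c"
    by (simp add: interval_lebesgue_integral_0_infty)
qed

lemma borel_measurable_fourier [measurable]:
  assumes [measurable]: "\<phi> \<in> borel_measurable borel"
  shows "fourier \<phi> \<in> borel_measurable borel"
  unfolding fourier_def[abs_def] by measurable

lemma norm_fourier_le: "norm (fourier \<phi> k) \<le> (LINT x|lborel. norm (\<phi> x))"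
proof -
  have "norm (fourier \<phi> k) \<le> (LINT x|lborel. norm (\<phi> x * exp (- (\<i> * of_real (k * x)))))"
    unfolding fourier_def by (rule integral_norm_bound)
  then show ?thesis by (simp add: norm_mult)
qed

lemma integrable_fourier_kernel:
  assumes "integrable lborel \<phi>"
  shows "integrable lborel (\<lambda>x. \<phi> x * exp (- (\<i> * of_real (k * x))))"
  by (rule Bochner_Integration.integrable_bound[OF assms])
     (use assms in \<open>auto simp: norm_mult\<close>)

text \<open>Damping by exp(-ax) makes the double integral absolutely convergent, so Fubini applies
  to any integrable \<phi>. The parameter \<open>s\<close> lets one statement serve both
  \<open>fourier \<phi> x\<close> and \<open>fourier \<phi> (- x)\<close>.\<close>

lemma
  assumes \<phi>: "integrable lborel \<phi>" and a: "a > 0"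
  shows set_integrable_laplace_fourier:
      "set_integrable lborel {0<..} (\<lambda>x. of_real (exp (- (a * x))) * fourier \<phi> (s * x))"
    and set_integral_laplace_fourier:
      "(LINT x:{0<..}|lborel. of_real (exp (- (a * x))) * fourier \<phi> (s * x))
       = (LINT y|lborel. \<phi> y / (of_real a + \<i> * of_real (s * y)))"
proof -
  have [measurable]: "\<phi> \<in> borel_measurable borel" using \<phi> by auto
  have [measurable]: "fourier \<phi> \<in> borel_measurable borel" by simp
  define f where "f x y = indicator {0<..} x *\<^sub>R (of_real (exp (- (a * x))) * (\<phi> y * exp (- (\<i> * of_real (s * x * y)))))"
    for x y
  \<comment> \<open>The integrand is factored in two ways: \<open>f_fst\<close> exposes the integral
    over y, which is \<open>fourier\<close>, and \<open>f_snd\<close> the integral over x, which is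
    an elementary Laplace integral.\<close>
  have f_fst: "f x y = indicator {0<..} x *\<^sub>R (of_real (exp (- (a * x)))) * (\<phi> y * exp (- (\<i> * of_real (s * x * y))))" for x y
    by (simp add: f_def)
  have f_snd: "f x y = \<phi> y * (indicator {0<..} x *\<^sub>R exp (- ((of_real a + \<i> * of_real (s * y)) * of_real x)))" for x y
  proof -
    have "exp (- ((of_real a + \<i> * of_real (s * y)) * of_real x))
        = of_real (exp (- (a * x))) * exp (- (\<i> * of_real (s * x * y)))"
      by (simp add: exp_of_real[symmetric] exp_add[symmetric] algebra_simps)
    then show ?thesis by (simp add: f_def)
  qed
  have exp_int: "set_integrable lborel {0<..} (\<lambda>x. exp (- (a * x)))"
    using integrable_I0i_exp_mscale[OF a] by (simp add: mult.commute)
  have "integrable (lborel \<Otimes>\<^sub>M lborel) (case_prod f)"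
  proof (rule lborel_pair.Fubini_integrable)
    have "(LINT y|lborel. norm (case_prod f (x, y)))
        = indicator {0<..} x *\<^sub>R exp (- (a * x)) * (LINT y|lborel. norm (\<phi> y))" for x
      by (simp add: f_fst norm_mult)
    then show "integrable lborel (\<lambda>x. LINT y|lborel. norm (case_prod f (x, y)))"
      using exp_int unfolding set_integrable_def by simp
    show "AE x in lborel. integrable lborel (\<lambda>y. case_prod f (x, y))"
      unfolding split_conv f_fst by (intro AE_I2 integrable_mult_right integrable_fourier_kernel \<phi>)
    show "case_prod f \<in> borel_measurable (lborel \<Otimes>\<^sub>M lborel)"
      unfolding f_def[abs_def] by measurable
  qed
  then have "(LINT y|lborel. LINT x|lborel. f x y) = (LINT x|lborel. LINT y|lborel. f x y)"
    by (rule lborel_pair.Fubini_integral)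
  moreover have "(LINT x|lborel. f x y) = \<phi> y / (of_real a + \<i> * of_real (s * y))" for y
  proof -
    have "(LINT x|lborel. f x y) = \<phi> y * (LINT x:{0<..}|lborel. exp (- ((of_real a + \<i> * of_real (s * y)) * of_real x)))"
      unfolding f_snd set_lebesgue_integral_def by (rule integral_mult_right_zero)
    then show ?thesis using a by (subst (asm) set_integral_exp_Ioi) auto
  qed
  moreover have "(LINT y|lborel. f x y) = indicator {0<..} x *\<^sub>R (of_real (exp (- (a * x))) * fourier \<phi> (s * x))" for x
    unfolding f_fst fourier_def by simp
  ultimately show "(LINT x:{0<..}|lborel. of_real (exp (- (a * x))) * fourier \<phi> (s * x))
       = (LINT y|lborel. \<phi> y / (of_real a + \<i> * of_real (s * y)))"
    by (simp add: set_lebesgue_integral_def)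
  have "set_integrable lborel {0<..} (\<lambda>x. exp (- (a * x)) * (LINT x|lborel. norm (\<phi> x)))"
    using exp_int by simp
  then show "set_integrable lborel {0<..} (\<lambda>x. of_real (exp (- (a * x))) * fourier \<phi> (s * x))"
    by (rule set_integrable_bound)
       (auto simp: set_borel_measurable_def norm_mult intro!: AE_I2 mult_left_mono order_trans[OF norm_fourier_le])
qed

section \<open>Decay of Schwartz functions and of their transforms\<close>

lemma nth_deriv_0 [simp]: "nth_deriv 0 \<phi> = \<phi>"
  by (simp add: nth_deriv_def)

context
  fixes \<phi> :: "real \<Rightarrow> complex"
  assumes \<phi>: "schwartz \<phi>"
begin

lemma schwartz_has_vector_derivative:
  "(nth_deriv n \<phi> has_vector_derivative nth_deriv (Suc n) \<phi> x) (at x)"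
proof -
  have "nth_deriv n \<phi> differentiable (at x)"
    using \<phi> by (simp add: schwartz_def)
  then have "(nth_deriv n \<phi> has_vector_derivative vector_derivative (nth_deriv n \<phi>) (at x)) (at x)"
    by (simp add: vector_derivative_works)
  then show ?thesis by (simp add: nth_deriv_def)
qed

lemma isCont_nth_deriv_schwartz: "isCont (nth_deriv n \<phi>) x"
  using schwartz_has_vector_derivative by (rule has_vector_derivative_continuous)

lemma borel_measurable_nth_deriv_schwartz [measurable]: "nth_deriv n \<phi> \<in> borel_measurable borel"
  using isCont_nth_deriv_schwartz by (intro borel_measurable_continuous_onI) (simp add: continuous_on_eq_continuous_at)

text \<open>Adding the Schwartz bounds for the powers m and m + 2 bounds the product with 1 +
  x^2.\<close>

lemma schwartz_moment_decay: "\<exists>C. \<forall>x. norm (of_real (x ^ m) * nth_deriv n \<phi> x) \<le> C / (1 + x\<^sup>2)"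
proof -
  obtain A where A: "\<And>x. norm (of_real (x ^ m) * nth_deriv n \<phi> x) \<le> A"
    using \<phi> unfolding schwartz_def by blast
  obtain B where B: "\<And>x. norm (of_real (x ^ (m + 2)) * nth_deriv n \<phi> x) \<le> B"
    using \<phi> unfolding schwartz_def by blast
  have "norm (of_real (x ^ m) * nth_deriv n \<phi> x) \<le> (A + B) / (1 + x\<^sup>2)" for x
  proof -
    have "norm (of_real (x ^ m) * nth_deriv n \<phi> x) * (1 + x\<^sup>2) \<le> A + B"
      using A[of x] B[of x] by (simp add: norm_mult norm_power power_add power2_eq_square algebra_simps flip: abs_mult)
    then show ?thesis
      by (simp add: pos_le_divide_eq add_pos_nonneg)
  qed
  then show ?thesis by blast
qed

lemma schwartz_decay: "\<exists>C. \<forall>x. norm (nth_deriv n \<phi> x) \<le> C / (1 + x\<^sup>2)"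
  using schwartz_moment_decay[of 0] by simp

lemma integrable_nth_deriv_schwartz: "integrable lborel (nth_deriv n \<phi>)"
  using schwartz_decay[of n] by (blast intro: integrable_quadratic_decay borel_measurable_nth_deriv_schwartz)

lemma tendsto_nth_deriv_schwartz:
  assumes "filterlim (\<lambda>x. \<bar>x\<bar>) at_top F"
  shows "(nth_deriv n \<phi> \<longlongrightarrow> 0) F"
proof -
  obtain C where C: "\<And>x. norm (nth_deriv n \<phi> x) \<le> C / (1 + x\<^sup>2)"
    using schwartz_decay by blast
  have "filterlim (\<lambda>x. \<bar>x\<bar> ^ 2) at_top F"
    by (rule filterlim_compose[OF filterlim_pow_at_top[OF _ filterlim_ident] assms]) simp
  then have "filterlim (\<lambda>x. 1 + x\<^sup>2) at_top F"
    by (intro filterlim_tendsto_add_at_top[OF tendsto_const]) simp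
  then have "((\<lambda>x. C / (1 + x\<^sup>2)) \<longlongrightarrow> 0) F"
    by (intro tendsto_divide_0[OF tendsto_const] filterlim_at_top_imp_at_infinity)
  then show ?thesis
    by (rule Lim_null_comparison[rotated]) (use C in simp)
qed

text \<open>Integration by parts: \<open>?f\<close> is the derivative of
  \<open>nth_deriv n \<phi> x * ?E x\<close>, which tends to 0 at both ends, so \<open>?f\<close>
  has integral 0 over the line.\<close>

lemma fourier_nth_deriv_Suc:
  "fourier (nth_deriv (Suc n) \<phi>) k = \<i> * of_real k * fourier (nth_deriv n \<phi>) k"
proof -
  let ?E = "\<lambda>x. exp (- (\<i> * of_real (k * x)))"
  let ?f = "\<lambda>x. nth_deriv (Suc n) \<phi> x * ?E x - \<i> * of_real k * (nth_deriv n \<phi> x * ?E x)"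
  have int: "integrable lborel (\<lambda>x. nth_deriv m \<phi> x * ?E x)" for m
    by (intro integrable_fourier_kernel integrable_nth_deriv_schwartz)
  have lim: "((\<lambda>x. nth_deriv n \<phi> x * ?E x) \<longlongrightarrow> 0) F" if "filterlim (\<lambda>x. \<bar>x\<bar>) at_top F" for F
    using tendsto_norm_zero[OF tendsto_nth_deriv_schwartz[OF that, of n]]
    by - (rule tendsto_norm_zero_cancel, simp add: norm_mult)
  have "(LBINT x=-\<infinity>..\<infinity>. ?f x) = 0 - 0"
  proof (rule interval_integral_FTC_integrable[where F = "\<lambda>x. nth_deriv n \<phi> x * ?E x"])
    show "((\<lambda>x. nth_deriv n \<phi> x * ?E x) has_vector_derivative ?f x) (at x)" for x
    proof -
      have "(?E has_vector_derivative - (\<i> * of_real k) * ?E x) (at x)"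
        unfolding of_real_mult
        by (rule has_vector_derivative_real_field[where f = "\<lambda>z. exp (- (\<i> * (of_real k * z)))"])
           (auto intro!: derivative_eq_intros)
      from has_vector_derivative_mult[OF schwartz_has_vector_derivative this]
      show ?thesis by (simp add: algebra_simps)
    qed
    show "isCont ?f x" for x
      by (intro continuous_intros isCont_nth_deriv_schwartz)
    show "set_integrable lborel (einterval (- \<infinity>) \<infinity>) ?f"
      using int[of "Suc n"] int[of n] by (simp add: set_integrable_def einterval_def)
    show "(((\<lambda>x. nth_deriv n \<phi> x * ?E x) \<circ> real_of_ereal) \<longlongrightarrow> 0) (at_right (- \<infinity>))"
      unfolding ereal_tendsto_simps
      using filterlim_compose[OF filterlim_abs_real filterlim_uminus_at_top_at_bot] by (intro lim) simp
    show "(((\<lambda>x. nth_deriv n \<phi> x * ?E x) \<circ> real_of_ereal) \<longlongrightarrow> 0) (at_left \<infinity>)"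
      unfolding ereal_tendsto_simps by (rule lim[OF filterlim_abs_real])
  qed simp
  then have "(LINT x|lborel. ?f x) = 0"
    by (simp add: interval_lebesgue_integral_def set_lebesgue_integral_def einterval_def)
  moreover have "(LINT x|lborel. ?f x) = fourier (nth_deriv (Suc n) \<phi>) k - \<i> * of_real k * fourier (nth_deriv n \<phi>) k"
    unfolding fourier_def using int[of "Suc n"] int[of n] by (subst Bochner_Integration.integral_diff) auto
  ultimately show ?thesis by simp
qed

text \<open>The derivative rule used twice turns k^2 times the transform into minus the transform of
  the second derivative. Both transforms are bounded by L1 norms, which add up to the
  constant.\<close>

lemma fourier_schwartz_decay: "\<exists>C\<ge>0. \<forall>k. norm (fourier \<phi> k) \<le> C / (1 + k\<^sup>2)"
proof -
  define B where "B n = (LINT x|lborel. norm (nth_deriv n \<phi> x))" for n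
  have "norm (fourier \<phi> k) \<le> (B 0 + B 2) / (1 + k\<^sup>2)" for k
  proof -
    have "fourier (nth_deriv 2 \<phi>) k = - (of_real (k\<^sup>2) * fourier \<phi> k)"
      using fourier_nth_deriv_Suc[of 0 k] fourier_nth_deriv_Suc[of 1 k]
      by (simp add: numeral_2_eq_2 algebra_simps)
    then have "norm (fourier \<phi> k) * (1 + k\<^sup>2) = norm (fourier (nth_deriv 0 \<phi>) k) + norm (fourier (nth_deriv 2 \<phi>) k)"
      by (simp add: norm_mult norm_power algebra_simps)
    also have "\<dots> \<le> B 0 + B 2"
      unfolding B_def by (intro add_mono norm_fourier_le)
    finally show ?thesis by (simp add: pos_le_divide_eq add_pos_nonneg)
  qed
  moreover have "B 0 + B 2 \<ge> 0" by (simp add: B_def)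
  ultimately show ?thesis by blast
qed

text \<open>The kernels at k and -k differ by -2i sin(kx), which is at most 2|kx| in modulus, so
  twice the first absolute moment of \<phi> is a valid constant. This linear vanishing compensates
  the pole of 1/(e^(\<beta>k) - 1) at 0.\<close>

lemma fourier_schwartz_odd_le: "\<exists>C. \<forall>k. norm (fourier \<phi> k - fourier \<phi> (- k)) \<le> C * \<bar>k\<bar>"
proof -
  obtain C where C: "\<And>x. norm (of_real (x ^ 1) * nth_deriv 0 \<phi> x) \<le> C / (1 + x\<^sup>2)"
    using schwartz_moment_decay by blast
  have meas: "\<phi> \<in> borel_measurable borel" using borel_measurable_nth_deriv_schwartz[of 0] by simp
  have int1: "integrable lborel (\<lambda>x. of_real x * \<phi> x)"
    by (rule integrable_quadratic_decay[where C = C]) (use C meas in auto)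
  have int: "integrable lborel (\<lambda>x. \<phi> x * exp (- (\<i> * of_real (k * x))))" for k
    using integrable_fourier_kernel[OF integrable_nth_deriv_schwartz[of 0]] by simp
  have "norm (fourier \<phi> k - fourier \<phi> (- k)) \<le> (2 * (LINT x|lborel. norm (of_real x * \<phi> x))) * \<bar>k\<bar>" for k
  proof -
    have "fourier \<phi> k - fourier \<phi> (- k)
        = (LINT x|lborel. \<phi> x * exp (- (\<i> * of_real (k * x))) - \<phi> x * exp (- (\<i> * of_real (- k * x))))"
      unfolding fourier_def by (rule Bochner_Integration.integral_diff[symmetric]) (rule int)+
    also have "norm \<dots> \<le> (LINT x|lborel. (2 * \<bar>k\<bar>) * norm (of_real x * \<phi> x))"
    proof (rule Bochner_Integration.integral_norm_bound_integral)
      fix x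
      have "exp (- (\<i> * of_real (k * x))) - exp (- (\<i> * of_real (- k * x))) = - 2 * \<i> * of_real (sin (k * x))"
        by (simp add: exp_Euler[symmetric] complex_eq_iff Re_exp Im_exp)
      then have "\<phi> x * exp (- (\<i> * of_real (k * x))) - \<phi> x * exp (- (\<i> * of_real (- k * x)))
          = \<phi> x * (- 2 * \<i> * of_real (sin (k * x)))"
        by (metis right_diff_distrib)
      then have "norm (\<phi> x * exp (- (\<i> * of_real (k * x))) - \<phi> x * exp (- (\<i> * of_real (- k * x))))
          = norm (\<phi> x) * (2 * \<bar>sin (k * x)\<bar>)"
        by (simp add: norm_mult)
      also have "\<dots> \<le> norm (\<phi> x) * (2 * \<bar>k * x\<bar>)"
        by (intro mult_left_mono abs_sin_x_le_abs_x) auto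
      finally show "norm (\<phi> x * exp (- (\<i> * of_real (k * x))) - \<phi> x * exp (- (\<i> * of_real (- k * x))))
          \<le> (2 * \<bar>k\<bar>) * norm (of_real x * \<phi> x)"
        by (simp add: norm_mult abs_mult algebra_simps)
    next
      show "integrable lborel (\<lambda>x. \<phi> x * exp (- (\<i> * of_real (k * x))) - \<phi> x * exp (- (\<i> * of_real (- k * x))))"
        by (intro Bochner_Integration.integrable_diff int)
      show "integrable lborel (\<lambda>x. 2 * \<bar>k\<bar> * norm (of_real x * \<phi> x))"
        using int1 by (intro integrable_mult_right integrable_norm)
    qed
    finally show ?thesis by (simp add: mult_ac)
  qed
  then show ?thesis by blast
qed

text \<open>Mean value inequality with a bounded first derivative; the segment from -x to x has
  length 2|x|, hence the factor 2. It compensates the poles of 1/y and coth at 0.\<close>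

lemma schwartz_odd_le: "\<exists>C. \<forall>x. norm (\<phi> x - \<phi> (- x)) \<le> C * \<bar>x\<bar>"
proof -
  obtain C where C: "\<And>x. norm (of_real (x ^ 0) * nth_deriv 1 \<phi> x) \<le> C"
    using \<phi> unfolding schwartz_def by blast
  have deriv: "(\<phi> has_vector_derivative nth_deriv 1 \<phi> x) (at x)" for x
    using schwartz_has_vector_derivative[of 0] by simp
  have "norm (\<phi> x - \<phi> (- x)) \<le> C * norm (x - - x)" for x
  proof (rule differentiable_bound[where S = UNIV])
    show "(\<phi> has_derivative (\<lambda>h. h *\<^sub>R nth_deriv 1 \<phi> y)) (at y within UNIV)" for y
      using deriv[of y] by (simp add: has_vector_derivative_def)
    show "onorm (\<lambda>h. h *\<^sub>R nth_deriv 1 \<phi> y) \<le> C" for y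
      using C[of y] by (intro onorm_le) (simp, metis abs_ge_zero mult.commute mult_right_mono)
  qed auto
  moreover have "norm (x - - x) = 2 * \<bar>x\<bar>" for x :: real
    by (simp add: abs_if)
  ultimately have "norm (\<phi> x - \<phi> (- x)) \<le> (2 * C) * \<bar>x\<bar>" for x
    by (simp only: mult.assoc mult.left_commute[of 2 C])
  then show ?thesis by blast
qed

end

subsection \<open>Domination estimates\<close>

text \<open>For y at most 1 the linear bound gives n/y \<le> A while 1 + y^2 \<le> 2, whence 2A. For
  y > 1 division by y only decreases n, whence B.\<close>

lemma divide_le_quadratic_decay:
  fixes n y :: real
  assumes "y > 0" "n \<ge> 0" "n \<le> A * y" "n \<le> B / (1 + y\<^sup>2)"
  shows "n / y \<le> (2 * A + B) / (1 + y\<^sup>2)"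
proof -
  have pos: "1 + y\<^sup>2 > 0" by (simp add: add_pos_nonneg)
  have A: "A \<ge> 0" using assms by (smt (verit) zero_le_mult_iff)
  have nB: "n * (1 + y\<^sup>2) \<le> B" using assms(4) pos by (simp add: pos_le_divide_eq)
  have B: "B \<ge> 0" using nB assms(2) pos by (smt (verit) mult_nonneg_nonneg)
  have "n / y * (1 + y\<^sup>2) \<le> 2 * A + B"
  proof (cases "y \<le> 1")
    case True
    have "n / y \<le> A" using assms(1,3) by (simp add: pos_divide_le_eq)
    moreover have "1 + y\<^sup>2 \<le> 2" using True assms(1) by (simp add: power_le_one)
    ultimately have "n / y * (1 + y\<^sup>2) \<le> A * 2"
      using A pos by (intro mult_mono) auto
    then show ?thesis using B by simp
  next
    case False
    then have "n / y \<le> n" using assms(2) by (simp add: divide_le_eq mult_le_cancel_left1)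
    then have "n / y * (1 + y\<^sup>2) \<le> n * (1 + y\<^sup>2)"
      using pos by (intro mult_right_mono) auto
    then show ?thesis using nB A by simp
  qed
  then show ?thesis using pos by (simp add: pos_le_divide_eq)
qed

text \<open>A function that is O(y) at 0 and decays quadratically tolerates a weight with a simple
  pole at 0 and bounded at infinity. All majorants on the half-line are obtained from this one
  estimate.\<close>

lemma set_integrable_Ioi_weight:
  fixes u :: "real \<Rightarrow> complex" and w :: "real \<Rightarrow> real"
  assumes [measurable]: "u \<in> borel_measurable borel" "w \<in> borel_measurable borel"
    and uA: "\<And>y. y > 0 \<Longrightarrow> norm (u y) \<le> A * y"
    and uB: "\<And>y. y > 0 \<Longrightarrow> norm (u y) \<le> B / (1 + y\<^sup>2)"
    and w: "\<And>y. y > 0 \<Longrightarrow> \<bar>w y\<bar> \<le> P + Q / y" and PQ: "P \<ge> 0" "Q \<ge> 0"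
  shows "set_integrable lborel {0<..} (\<lambda>y. of_real (w y) * u y)"
  unfolding set_integrable_def
proof (rule integrable_quadratic_decay[where C = "P * B + Q * (2 * A + B)"])
  fix x :: real
  have *: "norm (of_real (w y) * u y) \<le> (P * B + Q * (2 * A + B)) / (1 + y\<^sup>2)" if "y > 0" for y
  proof -
    have "norm (of_real (w y) * u y) \<le> (P + Q / y) * norm (u y)"
      using w[OF that] by (simp add: norm_mult mult_right_mono)
    also have "\<dots> = P * norm (u y) + Q * (norm (u y) / y)"
      by (simp add: algebra_simps)
    also have "\<dots> \<le> P * (B / (1 + y\<^sup>2)) + Q * ((2 * A + B) / (1 + y\<^sup>2))"
      using that uA uB PQ by (intro add_mono mult_left_mono divide_le_quadratic_decay) auto
    also have "\<dots> = (P * B + Q * (2 * A + B)) / (1 + y\<^sup>2)"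
      by (simp only: add_divide_distrib[of "P * B"] times_divide_eq_right)
    finally show ?thesis .
  qed
  \<comment> \<open>Off the half-line the integrand is 0, so the bound must be nonnegative there;
    the sign of its constant is read off from the estimate at y = 1.\<close>
  have "0 \<le> (P * B + Q * (2 * A + B)) / (1 + 1\<^sup>2)"
    using *[of 1] by (rule order_trans[OF norm_ge_zero]) simp
  then have "0 \<le> (P * B + Q * (2 * A + B)) / (1 + x\<^sup>2)"
    by (simp add: zero_le_divide_iff)
  with *[of x] show "norm (indicator {0<..} x *\<^sub>R (of_real (w x) * u x)) \<le> (P * B + Q * (2 * A + B)) / (1 + x\<^sup>2)"
    by (auto split: split_indicator)
qed simp

text \<open>Once the interval around 0 is cut out, the weight is bounded by P + Q/\<epsilon>, so
  plain integrability of \<open>u\<close> is enough.\<close>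

lemma set_integrable_outside_weight:
  fixes u w :: "real \<Rightarrow> complex"
  assumes u: "integrable lborel u" and [measurable]: "w \<in> borel_measurable borel"
    and w: "\<And>x. x \<noteq> 0 \<Longrightarrow> norm (w x) \<le> P + Q / \<bar>x\<bar>" and Q: "Q \<ge> 0" and e: "\<epsilon> > 0"
  shows "set_integrable lborel {x. \<epsilon> < \<bar>x\<bar>} (\<lambda>x. w x * u x)"
proof -
  have [measurable]: "u \<in> borel_measurable borel" using u by auto
  have "set_integrable lborel {x. \<epsilon> < \<bar>x\<bar>} (\<lambda>x. of_real (P + Q / \<epsilon>) * u x)"
    unfolding set_integrable_def using u by (intro integrable_mult_indicator integrable_mult_right) auto
  then show ?thesis
  proof (rule set_integrable_bound)
    have "norm (w x) \<le> \<bar>P + Q / \<epsilon>\<bar>" if "\<epsilon> < \<bar>x\<bar>" for x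
    proof -
      have "Q / \<bar>x\<bar> \<le> Q / \<epsilon>" using that Q e by (intro divide_left_mono) auto
      moreover have "norm (w x) \<le> P + Q / \<bar>x\<bar>" using that e by (intro w) auto
      ultimately show ?thesis by linarith
    qed
    then show "AE x in lborel. x \<in> {x. \<epsilon> < \<bar>x\<bar>} \<longrightarrow> norm (w x * u x) \<le> norm (of_real (P + Q / \<epsilon>) * u x)"
      unfolding norm_mult norm_of_real by (auto intro!: AE_I2 mult_right_mono)
  qed (simp add: set_borel_measurable_def)
qed

text \<open>Since the terms \<open>p k x\<close> are nonnegative, the partial sums lie between 0 and
  \<open>P x\<close>. The single function \<open>P x * u x\<close> therefore dominates all of
  them.\<close>

lemma set_integral_sums_dominated:
  fixes u :: "real \<Rightarrow> complex" and p :: "nat \<Rightarrow> real \<Rightarrow> real"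
  assumes [measurable]: "u \<in> borel_measurable borel" "\<And>k. p k \<in> borel_measurable borel"
    and p0: "\<And>k x. x > 0 \<Longrightarrow> p k x \<ge> 0" and sums: "\<And>x. x > 0 \<Longrightarrow> (\<lambda>k. p k x) sums P x"
    and int: "set_integrable lborel {0<..} (\<lambda>x. of_real (P x) * u x)"
  shows "(\<lambda>k. LINT x:{0<..}|lborel. of_real (p k x) * u x) sums (LINT x:{0<..}|lborel. of_real (P x) * u x)"
proof -
  let ?s = "\<lambda>k x. indicator {0<..} x *\<^sub>R (complex_of_real (p k x) * u x)"
  let ?f = "\<lambda>x. indicator {0<..} x *\<^sub>R (complex_of_real (P x) * u x)"
  have f: "integrable lborel ?f" using int by (simp add: set_integrable_def)
  have bound: "norm (\<Sum>k<N. ?s k x) \<le> norm (?f x)" for N x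
  proof (cases "x > 0")
    case True
    have "(\<Sum>k<N. ?s k x) = of_real (\<Sum>k<N. p k x) * u x"
      using True by (simp add: sum_distrib_right)
    moreover have "(\<Sum>k<N. p k x) \<le> P x"
      using sums[OF True] p0[OF True] sum_le_suminf[of "\<lambda>k. p k x" "{..<N}"] by (auto simp: sums_iff)
    moreover have "0 \<le> (\<Sum>k<N. p k x)"
      using p0[OF True] by (intro sum_nonneg) auto
    ultimately show ?thesis using True
      by (simp add: norm_mult mult_right_mono del: of_real_sum)
  qed simp
  have s: "integrable lborel (?s k)" for k
  proof (rule Bochner_Integration.integrable_bound[OF f])
    have "norm (?s k x) \<le> norm (?f x)" for x
    proof (cases "x > 0")
      case True
      have "p k x \<le> P x"
        using sums[OF True] p0[OF True] sum_le_suminf[of "\<lambda>k. p k x" "{k}"] by (auto simp: sums_iff)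
      then show ?thesis using True p0[OF True, of k] by (simp add: norm_mult mult_right_mono)
    qed simp
    then show "AE x in lborel. norm (?s k x) \<le> norm (?f x)" by (intro AE_I2)
  qed simp
  have "(\<lambda>N. LINT x|lborel. (\<Sum>k<N. ?s k x)) \<longlonglongrightarrow> (LINT x|lborel. ?f x)"
  proof (rule integral_dominated_convergence[where w = "\<lambda>x. norm (?f x)"])
    show "AE x in lborel. (\<lambda>N. \<Sum>k<N. ?s k x) \<longlonglongrightarrow> ?f x"
    proof (rule AE_I2)
      fix x :: real
      show "(\<lambda>N. \<Sum>k<N. ?s k x) \<longlonglongrightarrow> ?f x"
      proof (cases "x > 0")
        case True
        have "(\<lambda>k. complex_of_real (p k x) * u x) sums (of_real (P x) * u x)"
          using sums[OF True] by (intro sums_mult2) (simp add: sums_of_real_iff)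
        then show ?thesis using True by (simp add: sums_def)
      qed simp
    qed
    show "integrable lborel (\<lambda>x. norm (?f x))" using f by (rule integrable_norm)
    show "AE x in lborel. norm (\<Sum>k<N. ?s k x) \<le> norm (?f x)" for N
      using bound by (intro AE_I2)
    show "?f \<in> borel_measurable lborel" using f by (rule borel_measurable_integrable)
  qed measurable
  then show ?thesis
    unfolding sums_def set_lebesgue_integral_def by (subst (asm) Bochner_Integration.integral_sum) (rule s)
qed

section \<open>Bounds for the Bose function and for coth\<close>

lemma borel_measurable_cosh [measurable]: "(cosh :: real \<Rightarrow> real) \<in> borel_measurable borel"
  unfolding cosh_def[abs_def] by measurable

lemma borel_measurable_sinh [measurable]: "(sinh :: real \<Rightarrow> real) \<in> borel_measurable borel"
  unfolding sinh_def[abs_def] by measurable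

text \<open>It transfers bounds on 1/(e^t - 1) at t = 2z to coth z.\<close>

lemma coth_eq:
  fixes z :: real
  assumes "z \<noteq> 0"
  shows "cosh z / sinh z = 1 + 2 / (exp (2 * z) - 1)"
proof -
  have e: "exp (2 * z) = exp z * exp z" by (simp add: mult_exp_exp)
  have ne: "exp z * exp z \<noteq> 1" using assms by (simp flip: e)
  have "cosh z / sinh z = (exp z + inverse (exp z)) / (exp z - inverse (exp z))"
    by (simp only: cosh_def sinh_def exp_minus real_scaleR_def) (rule mult_divide_mult_cancel_left, simp)
  also have "\<dots> = (exp z * exp z + 1) / (exp z * exp z - 1)"
    using ne by (simp add: divide_simps)
  also have "\<dots> = 1 + 2 / (exp z * exp z - 1)"
    using ne by (simp add: field_simps)
  finally show ?thesis by (simp add: e)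
qed

lemma inverse_exp_minus_1_le:
  fixes t :: real
  assumes "t > 0"
  shows "0 \<le> 1 / (exp t - 1)" and "1 / (exp t - 1) \<le> 1 / t"
proof -
  have "t \<le> exp t - 1" using exp_ge_add_one_self[of t] by linarith
  with assms show "0 \<le> 1 / (exp t - 1)" "1 / (exp t - 1) \<le> 1 / t"
    by (simp, intro divide_left_mono) auto
qed

text \<open>The constant -1, the failure of oddness, is the origin of the delta term.\<close>

lemma inverse_exp_uminus_minus_1:
  fixes t :: real
  assumes "t \<noteq> 0"
  shows "1 / (exp (- t) - 1) = - 1 - 1 / (exp t - 1)"
  using assms by (simp add: exp_minus field_simps)

lemma abs_inverse_exp_minus_1_le:
  fixes t :: real
  assumes "t \<noteq> 0"
  shows "\<bar>1 / (exp t - 1)\<bar> \<le> 1 + 1 / \<bar>t\<bar>"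
proof (cases "t > 0")
  case True
  then show ?thesis using inverse_exp_minus_1_le[OF True] by simp
next
  case False
  with assms have t: "- t > 0" by simp
  show ?thesis
    using inverse_exp_minus_1_le[OF t] inverse_exp_uminus_minus_1[of "- t"] t
    by (simp only: minus_minus abs_minus_cancel neg_0_less_iff_less)
qed

lemma abs_coth_le:
  fixes z :: real
  assumes "z \<noteq> 0"
  shows "\<bar>cosh z / sinh z\<bar> \<le> 1 + 1 / \<bar>z\<bar>"
proof -
  have *: "\<bar>cosh t / sinh t\<bar> \<le> 1 + 1 / t" if "t > 0" for t :: real
    using inverse_exp_minus_1_le[of "2 * t"] that by (simp add: coth_eq)
  show ?thesis
    using *[of z] *[of "- z"] assms by (cases "z > 0") auto
qed

subsection \<open>Abel summation of the Fourier integral\<close>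

text \<open>These are the Poisson kernel and its conjugate, up to a factor. The second bound is the
  inequality 2|y|a \<le> a^2 + y^2.\<close>

lemma poisson_kernel_bounds:
  fixes a y :: real
  assumes "a > 0"
  shows "\<bar>a / (a\<^sup>2 + y\<^sup>2)\<bar> \<le> 1 / a" "\<bar>y / (a\<^sup>2 + y\<^sup>2)\<bar> \<le> 1 / a"
proof -
  have pos: "a\<^sup>2 + y\<^sup>2 > 0" using assms by (simp add: add_pos_nonneg)
  show "\<bar>a / (a\<^sup>2 + y\<^sup>2)\<bar> \<le> 1 / a"
    using assms pos by (simp add: abs_mult divide_simps power2_eq_square)
  have "2 * (\<bar>y\<bar> * a) \<le> a\<^sup>2 + y\<^sup>2"
    using sum_squares_bound[of "\<bar>y\<bar>" a] by (simp add: mult_ac)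
  moreover have "0 \<le> \<bar>y\<bar> * a" using assms by simp
  ultimately have "\<bar>y\<bar> * a \<le> a\<^sup>2 + y\<^sup>2" by linarith
  then show "\<bar>y / (a\<^sup>2 + y\<^sup>2)\<bar> \<le> 1 / a"
    using assms pos by (simp add: divide_simps mult_ac)
qed

lemma inverse_complex_kernel:
  fixes a y :: real
  assumes "a > 0"
  shows "1 / (of_real a + \<i> * of_real y) = of_real (a / (a\<^sup>2 + y\<^sup>2)) - \<i> * of_real (y / (a\<^sup>2 + y\<^sup>2))"
proof -
  have "a\<^sup>2 + y\<^sup>2 > 0" using assms by (simp add: add_pos_nonneg)
  then show ?thesis
    by (simp add: complex_eq_iff Re_divide Im_divide power2_eq_square[of "a\<^sup>2 + y\<^sup>2"])
qed

text \<open>The weights approach their limit from below in modulus, so the limiting integrand is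
  itself the majorant.\<close>

lemma set_integral_dominated_weight:
  fixes u :: "real \<Rightarrow> complex" and p :: "nat \<Rightarrow> real \<Rightarrow> real"
  assumes [measurable]: "u \<in> borel_measurable borel" "\<And>n. p n \<in> borel_measurable borel"
    and bound: "\<And>n x. x > 0 \<Longrightarrow> \<bar>p n x\<bar> \<le> P x" and lim: "\<And>x. x > 0 \<Longrightarrow> (\<lambda>n. p n x) \<longlonglongrightarrow> P x"
    and int: "set_integrable lborel {0<..} (\<lambda>x. of_real (P x) * u x)"
  shows "(\<lambda>n. LINT x:{0<..}|lborel. of_real (p n x) * u x) \<longlonglongrightarrow> (LINT x:{0<..}|lborel. of_real (P x) * u x)"
  unfolding set_lebesgue_integral_def
proof (rule integral_dominated_convergence)
  let ?f = "\<lambda>x. indicator {0<..} x *\<^sub>R (complex_of_real (P x) * u x)"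
  have f: "integrable lborel ?f" using int by (simp add: set_integrable_def)
  show "integrable lborel (\<lambda>x. norm (?f x))" using f by (rule integrable_norm)
  show "?f \<in> borel_measurable lborel" using f by (rule borel_measurable_integrable)
  show "AE x in lborel. (\<lambda>n. indicator {0<..} x *\<^sub>R (of_real (p n x) * u x)) \<longlonglongrightarrow> ?f x"
    using lim by (intro AE_I2) (auto split: split_indicator intro!: tendsto_intros)
  show "AE x in lborel. norm (indicator {0<..} x *\<^sub>R (of_real (p n x) * u x)) \<le> norm (?f x)" for n
    using order_trans[OF bound abs_ge_self]
    by (intro AE_I2) (auto split: split_indicator simp: norm_mult intro!: mult_right_mono)
qed measurable

context
  fixes \<phi> :: "real \<Rightarrow> complex"
  assumes \<phi>: "schwartz \<phi>"
begin

lemma borel_measurable_schwartz [measurable]: "\<phi> \<in> borel_measurable borel"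
  using borel_measurable_nth_deriv_schwartz[OF \<phi>, of 0] by simp

lemma borel_measurable_fourier_schwartz [measurable]: "fourier \<phi> \<in> borel_measurable borel"
  by (rule borel_measurable_fourier) (rule borel_measurable_schwartz)

lemma integrable_schwartz: "integrable lborel \<phi>"
  using integrable_nth_deriv_schwartz[OF \<phi>, of 0] by simp

lemma integrable_fourier_schwartz: "integrable lborel (fourier \<phi>)"
  using fourier_schwartz_decay[OF \<phi>] integrable_quadratic_decay[OF borel_measurable_fourier_schwartz]
  by blast

lemma set_integrable_schwartz_odd_weight:
  fixes w :: "real \<Rightarrow> real"
  assumes "w \<in> borel_measurable borel" "\<And>y. y > 0 \<Longrightarrow> \<bar>w y\<bar> \<le> P + Q / y" "P \<ge> 0" "Q \<ge> 0"
  shows "set_integrable lborel {0<..} (\<lambda>y. of_real (w y) * (\<phi> y - \<phi> (- y)))"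
proof -
  obtain A where A: "\<And>x. norm (\<phi> x - \<phi> (- x)) \<le> A * \<bar>x\<bar>"
    using schwartz_odd_le[OF \<phi>] by blast
  obtain B where B: "\<And>x. norm (\<phi> x) \<le> B / (1 + x\<^sup>2)"
    using schwartz_decay[OF \<phi>, of 0] by auto
  show ?thesis
  proof (rule set_integrable_Ioi_weight[where A = A and B = "2 * B" and P = P and Q = Q])
    show "norm (\<phi> y - \<phi> (- y)) \<le> A * y" if "y > 0" for y
      using A[of y] that by simp
    show "norm (\<phi> y - \<phi> (- y)) \<le> 2 * B / (1 + y\<^sup>2)" for y
      using norm_triangle_ineq4[of "\<phi> y" "\<phi> (- y)"] B[of y] B[of "- y"] by simp
  qed (use assms in simp_all)
qed

lemma set_integrable_fourier_odd_weight:
  fixes w :: "real \<Rightarrow> real"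
  assumes "w \<in> borel_measurable borel" "\<And>y. y > 0 \<Longrightarrow> \<bar>w y\<bar> \<le> P + Q / y" "P \<ge> 0" "Q \<ge> 0"
  shows "set_integrable lborel {0<..} (\<lambda>y. of_real (w y) * (fourier \<phi> y - fourier \<phi> (- y)))"
proof -
  obtain A where A: "\<And>x. norm (fourier \<phi> x - fourier \<phi> (- x)) \<le> A * \<bar>x\<bar>"
    using fourier_schwartz_odd_le[OF \<phi>] by blast
  obtain B where B: "\<And>x. norm (fourier \<phi> x) \<le> B / (1 + x\<^sup>2)"
    using fourier_schwartz_decay[OF \<phi>] by blast
  show ?thesis
  proof (rule set_integrable_Ioi_weight[where A = A and B = "2 * B" and P = P and Q = Q])
    show "norm (fourier \<phi> y - fourier \<phi> (- y)) \<le> A * y" if "y > 0" for y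
      using A[of y] that by simp
    show "norm (fourier \<phi> y - fourier \<phi> (- y)) \<le> 2 * B / (1 + y\<^sup>2)" for y
      using norm_triangle_ineq4[of "fourier \<phi> y" "fourier \<phi> (- y)"] B[of y] B[of "- y"] by simp
  qed (use assms in simp_all)
qed

lemma integrable_bounded_kernel:
  assumes "w \<in> borel_measurable borel" "\<And>y. norm (w y) \<le> K"
  shows "integrable lborel (\<lambda>y. w y * \<phi> y)"
proof (rule Bochner_Integration.integrable_bound)
  show "integrable lborel (\<lambda>y. of_real K * \<phi> y)"
    using integrable_schwartz by simp
  show "AE y in lborel. norm (w y * \<phi> y) \<le> norm (of_real K * \<phi> y)"
    using assms(2) by (intro AE_I2) (auto simp: norm_mult intro!: mult_right_mono order_trans[OF _ abs_ge_self])
qed (use assms(1) in simp)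

text \<open>The kernel 1/(a + iy) splits into an even part, which is common to both signs of x, and
  an odd part, which changes sign and sees only the odd part of \<phi>. As a tends to 0 these become
  the delta and the principal value of 1/y.\<close>

lemma integral_laplace_fourier_split:
  assumes a: "a > 0"
  shows "(LINT x:{0<..}|lborel. of_real (exp (- (a * x))) * fourier \<phi> x)
       = (LINT y|lborel. of_real (a / (a\<^sup>2 + y\<^sup>2)) * \<phi> y)
         - \<i> * (LINT y:{0<..}|lborel. of_real (y / (a\<^sup>2 + y\<^sup>2)) * (\<phi> y - \<phi> (- y)))" (is ?plus)
    and "(LINT x:{0<..}|lborel. of_real (exp (- (a * x))) * fourier \<phi> (- x))
       = (LINT y|lborel. of_real (a / (a\<^sup>2 + y\<^sup>2)) * \<phi> y)
         + \<i> * (LINT y:{0<..}|lborel. of_real (y / (a\<^sup>2 + y\<^sup>2)) * (\<phi> y - \<phi> (- y)))" (is ?minus)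
proof -
  have i1: "integrable lborel (\<lambda>y. of_real (a / (a\<^sup>2 + y\<^sup>2)) * \<phi> y)"
    using poisson_kernel_bounds(1)[OF a]
    by (intro integrable_bounded_kernel[where K = "1 / a"]) (simp, simp only: norm_of_real)
  have i2: "integrable lborel (\<lambda>y. of_real (y / (a\<^sup>2 + y\<^sup>2)) * \<phi> y)"
    using poisson_kernel_bounds(2)[OF a]
    by (intro integrable_bounded_kernel[where K = "1 / a"]) (simp, simp only: norm_of_real)
  have fold: "(LINT y|lborel. of_real (y / (a\<^sup>2 + y\<^sup>2)) * \<phi> y)
      = (LINT y:{0<..}|lborel. of_real (y / (a\<^sup>2 + y\<^sup>2)) * (\<phi> y - \<phi> (- y)))"
    by (subst integral_fold[OF i2]) (simp add: right_diff_distrib diff_divide_distrib)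
  \<comment> \<open>Both signs are treated at once; s^2 = 1 is what turns a^2 + (sy)^2 into a^2 +
    y^2.\<close>
  have *: "(LINT x:{0<..}|lborel. of_real (exp (- (a * x))) * fourier \<phi> (s * x))
      = (LINT y|lborel. of_real (a / (a\<^sup>2 + y\<^sup>2)) * \<phi> y)
         - \<i> * of_real s * (LINT y|lborel. of_real (y / (a\<^sup>2 + y\<^sup>2)) * \<phi> y)" if "s\<^sup>2 = 1" for s
  proof -
    have "(LINT x:{0<..}|lborel. of_real (exp (- (a * x))) * fourier \<phi> (s * x))
        = (LINT y|lborel. \<phi> y / (of_real a + \<i> * of_real (s * y)))"
      by (rule set_integral_laplace_fourier[OF integrable_schwartz a])
    also have "\<dots> = (LINT y|lborel. of_real (a / (a\<^sup>2 + y\<^sup>2)) * \<phi> y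
        - \<i> * of_real s * (of_real (y / (a\<^sup>2 + y\<^sup>2)) * \<phi> y))"
    proof (rule Bochner_Integration.integral_cong[OF refl])
      fix y
      have "\<phi> y / (of_real a + \<i> * of_real (s * y)) = \<phi> y * (1 / (of_real a + \<i> * of_real (s * y)))"
        by simp
      also have "\<dots> = \<phi> y * (of_real (a / (a\<^sup>2 + y\<^sup>2)) - \<i> * of_real (s * y / (a\<^sup>2 + y\<^sup>2)))"
        unfolding inverse_complex_kernel[OF a] power_mult_distrib that mult_1_left ..
      also have "\<dots> = of_real (a / (a\<^sup>2 + y\<^sup>2)) * \<phi> y
        - \<i> * of_real s * (of_real (y / (a\<^sup>2 + y\<^sup>2)) * \<phi> y)"
        by (simp add: algebra_simps)
      finally show "\<phi> y / (of_real a + \<i> * of_real (s * y)) = \<dots>" .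
    qed
    also have "\<dots> = (LINT y|lborel. of_real (a / (a\<^sup>2 + y\<^sup>2)) * \<phi> y)
         - \<i> * of_real s * (LINT y|lborel. of_real (y / (a\<^sup>2 + y\<^sup>2)) * \<phi> y)"
      using i1 i2 by (subst Bochner_Integration.integral_diff) (auto simp del: of_real_divide)
    finally show ?thesis .
  qed
  show ?plus using *[of 1] unfolding fold by simp
  show ?minus using *[of "- 1"] unfolding fold by simp
qed

lemma integral_laplace_fourier_odd:
  assumes a: "a > 0"
  shows "(LINT x:{0<..}|lborel. of_real (exp (- (a * x))) * (fourier \<phi> x - fourier \<phi> (- x)))
       = - 2 * \<i> * (LINT y:{0<..}|lborel. of_real (y / (a\<^sup>2 + y\<^sup>2)) * (\<phi> y - \<phi> (- y)))"
proof -
  have "(LINT x:{0<..}|lborel. of_real (exp (- (a * x))) * (fourier \<phi> x - fourier \<phi> (- x)))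
      = (LINT x:{0<..}|lborel. of_real (exp (- (a * x))) * fourier \<phi> x)
      - (LINT x:{0<..}|lborel. of_real (exp (- (a * x))) * fourier \<phi> (- x))"
    using set_integrable_laplace_fourier[OF integrable_schwartz a, of 1]
      set_integrable_laplace_fourier[OF integrable_schwartz a, of "- 1"]
    by (subst set_integral_diff(2)[symmetric]) (auto simp: right_diff_distrib)
  then show ?thesis
    unfolding integral_laplace_fourier_split[OF a] by simp
qed

text \<open>Approximate identity: substituting y = cu moves the parameter from the kernel into the
  argument of \<phi>. The fixed kernel 1/(1 + u^2) has mass pi, and a bound on \<phi> gives the
  majorant.\<close>

lemma integral_poisson_kernel_tendsto:
  assumes a: "\<And>n. a n > 0" "a \<longlonglongrightarrow> 0"
  shows "(\<lambda>n. LINT y|lborel. of_real (a n / ((a n)\<^sup>2 + y\<^sup>2)) * \<phi> y) \<longlonglongrightarrow> of_real pi * \<phi> 0"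
proof -
  obtain B where B: "\<And>x. norm (of_real (x ^ 0) * nth_deriv 0 \<phi> x) \<le> B"
    using \<phi> unfolding schwartz_def by blast
  have eq: "(LINT y|lborel. of_real (c / (c\<^sup>2 + y\<^sup>2)) * \<phi> y)
      = (LINT u|lborel. of_real (1 / (1 + u\<^sup>2)) * \<phi> (c * u))" if "c > 0" for c
  proof -
    have "(LINT y|lborel. of_real (c / (c\<^sup>2 + y\<^sup>2)) * \<phi> y)
      = c *\<^sub>R (LINT u|lborel. of_real (c / (c\<^sup>2 + (c * u)\<^sup>2)) * \<phi> (c * u))"
      using that lborel_integral_real_affine[of c "\<lambda>y. of_real (c / (c\<^sup>2 + y\<^sup>2)) * \<phi> y" 0]
      by (simp only: abs_of_pos add_0)
    also have "\<dots> = (LINT u|lborel. c *\<^sub>R (of_real (c / (c\<^sup>2 + (c * u)\<^sup>2)) * \<phi> (c * u)))"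
      by (rule integral_scaleR_right[symmetric])
    also have "\<dots> = (LINT u|lborel. of_real (1 / (1 + u\<^sup>2)) * \<phi> (c * u))"
    proof (rule Bochner_Integration.integral_cong[OF refl])
      fix u :: real
      have "c\<^sup>2 + (c * u)\<^sup>2 = c * c * (1 + u\<^sup>2)" by (simp add: power2_eq_square algebra_simps)
      then have "c * (c / (c\<^sup>2 + (c * u)\<^sup>2)) = 1 / (1 + u\<^sup>2)"
        using that by simp
      then show "c *\<^sub>R (of_real (c / (c\<^sup>2 + (c * u)\<^sup>2)) * \<phi> (c * u)) = of_real (1 / (1 + u\<^sup>2)) * \<phi> (c * u)"
        by (metis mult.assoc of_real_mult scaleR_conv_of_real)
    qed
    finally show ?thesis .
  qed
  have "(\<lambda>n. LINT u|lborel. of_real (1 / (1 + u\<^sup>2)) * \<phi> (a n * u))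
      \<longlonglongrightarrow> (LINT u|lborel. complex_of_real (1 / (1 + u\<^sup>2)) * \<phi> 0)"
  proof (rule integral_dominated_convergence[where w = "\<lambda>u. B * (1 / (1 + u\<^sup>2))"])
    show "integrable lborel (\<lambda>u. B * (1 / (1 + u\<^sup>2)))"
      by (intro integrable_mult_right integrable_inverse_1_plus_square')
    have "(\<lambda>n. \<phi> (a n * u)) \<longlonglongrightarrow> \<phi> 0" for u
    proof -
      have "isCont \<phi> 0" using isCont_nth_deriv_schwartz[OF \<phi>, of 0 0] by simp
      moreover have "(\<lambda>n. a n * u) \<longlonglongrightarrow> 0" using tendsto_mult_left_zero[OF a(2)] .
      ultimately show ?thesis by (rule isCont_tendsto_compose)
    qed
    then show "AE u in lborel. (\<lambda>n. of_real (1 / (1 + u\<^sup>2)) * \<phi> (a n * u)) \<longlonglongrightarrow> of_real (1 / (1 + u\<^sup>2)) * \<phi> 0"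
      by (intro AE_I2 tendsto_mult tendsto_const)
    show "AE u in lborel. norm (of_real (1 / (1 + u\<^sup>2)) * \<phi> (a n * u)) \<le> B * (1 / (1 + u\<^sup>2))" for n
    proof (rule AE_I2)
      fix u :: real
      have "norm (of_real (1 / (1 + u\<^sup>2)) * \<phi> (a n * u)) = norm (\<phi> (a n * u)) * (1 / (1 + u\<^sup>2))"
        unfolding norm_mult norm_of_real by (simp add: mult.commute)
      also have "\<dots> \<le> B * (1 / (1 + u\<^sup>2))"
        using B[of "a n * u"] by (intro mult_right_mono) auto
      finally show "norm (of_real (1 / (1 + u\<^sup>2)) * \<phi> (a n * u)) \<le> B * (1 / (1 + u\<^sup>2))" .
    qed
  qed measurable
  moreover have "(LINT u|lborel. complex_of_real (1 / (1 + u\<^sup>2)) * \<phi> 0) = of_real pi * \<phi> 0"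
    using integral_inverse_1_plus_square'
    by (simp only: integral_mult_left_zero integral_complex_of_real)
  ultimately show ?thesis
    using eq[OF a(1)] by simp
qed

text \<open>An integrated Sokhotski-Plemelj formula: as a distribution in y, the integral of e^(ixy)
  over x > 0 is pi times delta plus i times the principal value of 1/y. The same damped integral is
  evaluated in the limit in two ways.\<close>

lemma set_integral_fourier_Ioi:
  "(LINT x:{0<..}|lborel. fourier \<phi> (- x))
   = of_real pi * \<phi> 0 + \<i> * (LINT y:{0<..}|lborel. of_real (1 / y) * (\<phi> y - \<phi> (- y)))"
proof -
  define a where "a n = inverse (real (Suc n))" for n
  have a: "\<And>n. a n > 0" "a \<longlonglongrightarrow> 0"
    unfolding a_def by (simp, rule LIMSEQ_inverse_real_of_nat)
  have "set_integrable lborel {0<..} (\<lambda>x. fourier \<phi> (- x))"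
    unfolding set_integrable_def
    using lborel_integrable_real_affine[OF integrable_fourier_schwartz, of "-1" 0]
    by (intro integrable_mult_indicator) auto
  \<comment> \<open>The limit weight is the constant 1, kept as \<open>of_real 1\<close> to fit the
    dominated convergence lemma.\<close>
  then have "(\<lambda>n. LINT x:{0<..}|lborel. of_real (exp (- (a n * x))) * fourier \<phi> (- x))
      \<longlonglongrightarrow> (LINT x:{0<..}|lborel. of_real 1 * fourier \<phi> (- x))"
    using a by (intro set_integral_dominated_weight)
      (auto intro!: tendsto_eq_intros simp: less_imp_le)
  moreover have "(\<lambda>n. LINT y:{0<..}|lborel. of_real (y / ((a n)\<^sup>2 + y\<^sup>2)) * (\<phi> y - \<phi> (- y)))
      \<longlonglongrightarrow> (LINT y:{0<..}|lborel. of_real (1 / y) * (\<phi> y - \<phi> (- y)))"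
  proof (rule set_integral_dominated_weight)
    show "set_integrable lborel {0<..} (\<lambda>y. of_real (1 / y) * (\<phi> y - \<phi> (- y)))"
      by (rule set_integrable_schwartz_odd_weight[where P = 0 and Q = 1]) auto
    fix y :: real assume y: "y > 0"
    \<comment> \<open>This is the Poisson bound with the roles of \<open>a n\<close> and
      \<open>y\<close> exchanged.\<close>
    show "\<bar>y / ((a n)\<^sup>2 + y\<^sup>2)\<bar> \<le> 1 / y" for n
      using poisson_kernel_bounds(1)[OF y, of "a n"] by (simp add: add.commute)
    have "(\<lambda>n. y / ((a n)\<^sup>2 + y\<^sup>2)) \<longlonglongrightarrow> y / (0\<^sup>2 + y\<^sup>2)"
      using y a by (intro tendsto_intros) auto
    then show "(\<lambda>n. y / ((a n)\<^sup>2 + y\<^sup>2)) \<longlonglongrightarrow> 1 / y"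
      using y by (simp add: power2_eq_square)
  qed measurable
  then have "(\<lambda>n. LINT x:{0<..}|lborel. of_real (exp (- (a n * x))) * fourier \<phi> (- x))
      \<longlonglongrightarrow> of_real pi * \<phi> 0 + \<i> * (LINT y:{0<..}|lborel. of_real (1 / y) * (\<phi> y - \<phi> (- y)))"
    unfolding integral_laplace_fourier_split[OF a(1)]
    by (rule tendsto_add[OF integral_poisson_kernel_tendsto[OF a] tendsto_mult[OF tendsto_const]])
  ultimately show ?thesis
    using LIMSEQ_unique by fastforce
qed

lemma set_integral_bose_fourier_odd:
  assumes b: "\<beta> > 0"
  shows "(LINT x:{0<..}|lborel. of_real (1 / (exp (\<beta> * x) - 1)) * (fourier \<phi> x - fourier \<phi> (- x)))
    = - 2 * \<i> * (LINT y:{0<..}|lborel.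
        of_real (pi / (2 * \<beta>) * (cosh (pi * y / \<beta>) / sinh (pi * y / \<beta>)) - 1 / (2 * y)) * (\<phi> y - \<phi> (- y)))"
proof -
  let ?D = "\<lambda>x. fourier \<phi> x - fourier \<phi> (- x)" and ?\<psi> = "\<lambda>y. \<phi> y - \<phi> (- y)"
  let ?L = "\<lambda>x. 1 / (exp (\<beta> * x) - 1)"
  let ?R = "\<lambda>y. pi / (2 * \<beta>) * (cosh (pi * y / \<beta>) / sinh (pi * y / \<beta>)) - 1 / (2 * y)"
  \<comment> \<open>The geometric series for 1/(e^t - 1) starts with e^(-t), so the rates start at
    \<beta>. The absent pole at n = 0 is the term 1/(2y) subtracted in \<open>?R\<close>.\<close>
  let ?a = "\<lambda>k. real (Suc k) * \<beta>"
  have "(\<lambda>k. LINT x:{0<..}|lborel. of_real (exp (- (?a k * x))) * ?D x)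
      sums (LINT x:{0<..}|lborel. of_real (?L x) * ?D x)"
  proof (rule set_integral_sums_dominated)
    fix x :: real assume x: "x > 0"
    have "(\<lambda>k. exp (- (\<beta> * x)) * exp (- (\<beta> * x)) ^ k) sums (exp (- (\<beta> * x)) * (1 / (1 - exp (- (\<beta> * x)))))"
      using b x by (intro sums_mult geometric_sums) simp
    also have "exp (- (\<beta> * x)) * (1 / (1 - exp (- (\<beta> * x)))) = ?L x"
      using b x by (simp add: exp_minus field_simps)
    also have "(\<lambda>k. exp (- (\<beta> * x)) * exp (- (\<beta> * x)) ^ k) = (\<lambda>k. exp (- (?a k * x)))"
      by (simp add: exp_of_nat_mult[symmetric] exp_add[symmetric] algebra_simps)
    finally show "(\<lambda>k. exp (- (?a k * x))) sums ?L x" .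
  next
    show "set_integrable lborel {0<..} (\<lambda>x. of_real (?L x) * ?D x)"
    proof (rule set_integrable_fourier_odd_weight[where P = 0 and Q = "1 / \<beta>"])
      show "\<bar>?L x\<bar> \<le> 0 + 1 / \<beta> / x" if "x > 0" for x
        using inverse_exp_minus_1_le[of "\<beta> * x"] b that by simp
    qed (use b in auto)
  qed auto
  moreover have "(\<lambda>k. - 2 * \<i> * (LINT y:{0<..}|lborel. of_real (y / ((?a k)\<^sup>2 + y\<^sup>2)) * ?\<psi> y))
      sums (- 2 * \<i> * (LINT y:{0<..}|lborel. of_real (?R y) * ?\<psi> y))"
  proof (intro sums_mult set_integral_sums_dominated)
    fix y :: real assume y: "y > 0"
    \<comment> \<open>The expansion of coth is taken at \<tau> = y/\<beta>; the factor 1/(2\<beta>)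
      normalises its terms to y/(n^2 \<beta>^2 + y^2).\<close>
    have "(\<lambda>k. 1 / (2 * \<beta>) * (2 * (y / \<beta>) / ((y / \<beta>)\<^sup>2 + (real (Suc k))\<^sup>2)))
        sums (1 / (2 * \<beta>) * (pi * cosh (pi * (y / \<beta>)) / sinh (pi * (y / \<beta>)) - 1 / (y / \<beta>)))"
      using b y by (intro sums_mult coth_partial_fractions) simp
    also have "(\<lambda>k. 1 / (2 * \<beta>) * (2 * (y / \<beta>) / ((y / \<beta>)\<^sup>2 + (real (Suc k))\<^sup>2))) = (\<lambda>k. y / ((?a k)\<^sup>2 + y\<^sup>2))"
    proof
      fix k
      have "(?a k)\<^sup>2 + y\<^sup>2 = \<beta>\<^sup>2 * ((y / \<beta>)\<^sup>2 + (real (Suc k))\<^sup>2)"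
        using b by (simp add: power_mult_distrib power_divide distrib_left del: of_nat_Suc)
      then show "1 / (2 * \<beta>) * (2 * (y / \<beta>) / ((y / \<beta>)\<^sup>2 + (real (Suc k))\<^sup>2)) = y / ((?a k)\<^sup>2 + y\<^sup>2)"
        using b by (simp add: power2_eq_square)
    qed
    also have "1 / (2 * \<beta>) * (pi * cosh (pi * (y / \<beta>)) / sinh (pi * (y / \<beta>)) - 1 / (y / \<beta>)) = ?R y"
      using b y by (simp add: right_diff_distrib)
    finally show "(\<lambda>k. y / ((?a k)\<^sup>2 + y\<^sup>2)) sums ?R y" .
  next
    show "set_integrable lborel {0<..} (\<lambda>y. of_real (?R y) * ?\<psi> y)"
    proof (rule set_integrable_schwartz_odd_weight[where P = "pi / (2 * \<beta>)" and Q = 1])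
      \<comment> \<open>The pole of coth and the subtracted term contribute 1/(2y) each. They would
        cancel, but the triangle inequality suffices.\<close>
      show "\<bar>?R y\<bar> \<le> pi / (2 * \<beta>) + 1 / y" if "y > 0" for y
      proof -
        have "\<bar>?R y\<bar> \<le> \<bar>pi / (2 * \<beta>) * (cosh (pi * y / \<beta>) / sinh (pi * y / \<beta>))\<bar> + \<bar>1 / (2 * y)\<bar>"
          by (rule abs_triangle_ineq4)
        also have "\<dots> \<le> pi / (2 * \<beta>) * (1 + 1 / \<bar>pi * y / \<beta>\<bar>) + 1 / (2 * y)"
          using abs_coth_le[of "pi * y / \<beta>"] b that
          unfolding abs_mult[of "pi / (2 * \<beta>)"] by (intro add_mono mult_mono) auto
        also have "\<dots> = pi / (2 * \<beta>) + 1 / y"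
          using b that by (simp add: field_simps)
        finally show ?thesis .
      qed
    qed (use b in auto)
  qed auto
  moreover have "(LINT x:{0<..}|lborel. of_real (exp (- (?a k * x))) * ?D x)
      = - 2 * \<i> * (LINT y:{0<..}|lborel. of_real (y / ((?a k)\<^sup>2 + y\<^sup>2)) * ?\<psi> y)" for k
    using b by (intro integral_laplace_fourier_odd) simp
  ultimately show ?thesis
    using sums_unique2 by simp
qed

end

subsection \<open>The Bose and Fermi functions\<close>

text \<open>The parameter stays explicit because the Fermi case uses the function at \<beta> and at
  2\<beta>.\<close>

definition bose :: "real \<Rightarrow> real \<Rightarrow> complex" where
  "bose \<beta> x = 1 / of_real (exp (\<beta> * x) - 1)"

definition bose_transform :: "real \<Rightarrow> real \<Rightarrow> complex" where
  "bose_transform \<beta> x = of_real pi / (\<i> * of_real \<beta>) * of_real (cosh (pi * x / \<beta>) / sinh (pi * x / \<beta>))"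

lemma bose_transform_eq: "bose_transform \<beta> x = - \<i> * of_real (pi / \<beta> * (cosh (pi * x / \<beta>) / sinh (pi * x / \<beta>)))"
  by (simp add: bose_transform_def divide_simps)

context
  fixes \<phi> :: "real \<Rightarrow> complex" and \<beta> :: real
  assumes \<phi>: "schwartz \<phi>" and b: "\<beta> > 0"
begin

lemma set_integrable_bose_fourier:
  assumes "\<epsilon> > 0"
  shows "set_integrable lborel {x. \<epsilon> < \<bar>x\<bar>} (\<lambda>x. bose \<beta> x * fourier \<phi> x)"
proof (rule set_integrable_outside_weight[OF integrable_fourier_schwartz[OF \<phi>] _ _ _ assms])
  show "bose \<beta> \<in> borel_measurable borel"
    unfolding bose_def[abs_def] by measurable
  show "norm (bose \<beta> x) \<le> 1 + 1 / \<beta> / \<bar>x\<bar>" if "x \<noteq> 0" for x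
  proof -
    have "norm (bose \<beta> x) = \<bar>1 / (exp (\<beta> * x) - 1)\<bar>"
      unfolding bose_def norm_divide norm_of_real by simp
    also have "\<dots> \<le> 1 + 1 / \<bar>\<beta> * x\<bar>"
      using that b by (intro abs_inverse_exp_minus_1_le) simp
    finally show ?thesis using b by (simp add: abs_mult)
  qed
qed (use b in simp)

lemma set_integrable_bose_transform:
  assumes "\<epsilon> > 0"
  shows "set_integrable lborel {x. \<epsilon> < \<bar>x\<bar>} (\<lambda>x. bose_transform \<beta> x * \<phi> x)"
proof (rule set_integrable_outside_weight[OF integrable_schwartz[OF \<phi>] _ _ _ assms])
  show "bose_transform \<beta> \<in> borel_measurable borel"
    unfolding bose_transform_def[abs_def] by measurable
  show "norm (bose_transform \<beta> x) \<le> pi / \<beta> + 1 / \<bar>x\<bar>" if "x \<noteq> 0" for x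
  proof -
    have "norm (bose_transform \<beta> x) = pi / \<beta> * \<bar>cosh (pi * x / \<beta>) / sinh (pi * x / \<beta>)\<bar>"
      unfolding bose_transform_eq norm_mult norm_of_real abs_mult using b by simp
    also have "\<dots> \<le> pi / \<beta> * (1 + 1 / \<bar>pi * x / \<beta>\<bar>)"
      using that b by (intro mult_left_mono abs_coth_le) auto
    also have "\<dots> = pi / \<beta> + 1 / \<bar>x\<bar>"
      using that b by (simp add: abs_mult field_simps)
    finally show ?thesis .
  qed
qed simp

lemma set_integrable_coth_schwartz_odd:
  "set_integrable lborel {0<..} (\<lambda>y. of_real (pi / \<beta> * (cosh (pi * y / \<beta>) / sinh (pi * y / \<beta>))) * (\<phi> y - \<phi> (- y)))"
proof (rule set_integrable_schwartz_odd_weight[OF \<phi>, where P = "pi / \<beta>" and Q = 1])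
  show "\<bar>pi / \<beta> * (cosh (pi * y / \<beta>) / sinh (pi * y / \<beta>))\<bar> \<le> pi / \<beta> + 1 / y" if "y > 0" for y
  proof -
    have "\<bar>pi / \<beta> * (cosh (pi * y / \<beta>) / sinh (pi * y / \<beta>))\<bar> \<le> pi / \<beta> * (1 + 1 / \<bar>pi * y / \<beta>\<bar>)"
      unfolding abs_mult[of "pi / \<beta>"] using that b by (intro mult_mono abs_coth_le) auto
    also have "\<dots> = pi / \<beta> + 1 / y"
      using that b by (simp add: field_simps)
    finally show ?thesis .
  qed
qed (use b in \<open>measurable, simp_all\<close>)

text \<open>As coth is odd, only the odd part of \<phi> survives, and it vanishes at the
  pole.\<close>

lemma bose_transform_fold:
  "bose_transform \<beta> x * \<phi> x + bose_transform \<beta> (- x) * \<phi> (- x)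
   = - \<i> * (of_real (pi / \<beta> * (cosh (pi * x / \<beta>) / sinh (pi * x / \<beta>))) * (\<phi> x - \<phi> (- x)))"
  unfolding bose_transform_eq by (simp add: algebra_simps diff_divide_distrib)

lemma tendsto_bose_transform:
  "((\<lambda>\<epsilon>. LINT x:{x. \<epsilon> < \<bar>x\<bar>}|lborel. bose_transform \<beta> x * \<phi> x) \<longlongrightarrow>
    - \<i> * (LINT y:{0<..}|lborel. of_real (pi / \<beta> * (cosh (pi * y / \<beta>) / sinh (pi * y / \<beta>))) * (\<phi> y - \<phi> (- y))))
     (at_right 0)"
proof -
  have "set_integrable lborel {0<..} (\<lambda>x. bose_transform \<beta> x * \<phi> x + bose_transform \<beta> (- x) * \<phi> (- x))"
    unfolding bose_transform_fold by (rule set_integrable_mult_right) (rule set_integrable_coth_schwartz_odd)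
  from tendsto_principal_value[OF set_integrable_bose_transform this]
  show ?thesis
    unfolding bose_transform_fold set_integral_mult_right .
qed

lemma bose_fold:
  assumes "x \<noteq> 0"
  shows "bose \<beta> x * fourier \<phi> x + bose \<beta> (- x) * fourier \<phi> (- x)
   = of_real (1 / (exp (\<beta> * x) - 1)) * (fourier \<phi> x - fourier \<phi> (- x)) - fourier \<phi> (- x)"
proof -
  have "bose \<beta> (- x) = of_real (1 / (exp (- (\<beta> * x)) - 1))"
    by (simp add: bose_def)
  also have "\<dots> = - 1 - of_real (1 / (exp (\<beta> * x) - 1))"
    using assms b by (subst inverse_exp_uminus_minus_1) auto
  finally have "bose \<beta> (- x) = - 1 - of_real (1 / (exp (\<beta> * x) - 1))" .
  moreover have "bose \<beta> x = of_real (1 / (exp (\<beta> * x) - 1))"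
    by (simp add: bose_def)
  ultimately show ?thesis
    by (simp only: left_diff_distrib right_diff_distrib) simp
qed

text \<open>Let C and J be the half-line integrals of \<open>?\<psi>\<close> against
  \<open>?k\<close> and 1/y. The odd part contributes -2i(C/2 - J/2) and the regular part -(pi
  \<phi>(0) + iJ), so J cancels and -pi \<phi>(0) - iC remains.\<close>

lemma tendsto_bose_fourier:
  "((\<lambda>\<epsilon>. LINT x:{x. \<epsilon> < \<bar>x\<bar>}|lborel. bose \<beta> x * fourier \<phi> x) \<longlongrightarrow> - of_real pi * \<phi> 0 +
    - \<i> * (LINT y:{0<..}|lborel. of_real (pi / \<beta> * (cosh (pi * y / \<beta>) / sinh (pi * y / \<beta>))) * (\<phi> y - \<phi> (- y))))
     (at_right 0)"
proof -
  let ?F = "\<lambda>x. bose \<beta> x * fourier \<phi> x"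
  let ?G = "\<lambda>x. of_real (1 / (exp (\<beta> * x) - 1)) * (fourier \<phi> x - fourier \<phi> (- x))"
  let ?\<psi> = "\<lambda>y. \<phi> y - \<phi> (- y)"
  let ?k = "\<lambda>y. pi / \<beta> * (cosh (pi * y / \<beta>) / sinh (pi * y / \<beta>))"
  have G: "set_integrable lborel {0<..} ?G"
  proof (rule set_integrable_fourier_odd_weight[OF \<phi>, where P = 0 and Q = "1 / \<beta>"])
    show "\<bar>1 / (exp (\<beta> * x) - 1)\<bar> \<le> 0 + 1 / \<beta> / x" if "x > 0" for x
      using inverse_exp_minus_1_le[of "\<beta> * x"] b that by simp
  qed (use b in auto)
  have H: "set_integrable lborel {0<..} (\<lambda>x. fourier \<phi> (- x))"
    unfolding set_integrable_def
    using lborel_integrable_real_affine[OF integrable_fourier_schwartz[OF \<phi>], of "-1" 0]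
    by (intro integrable_mult_indicator) auto
  have R: "set_integrable lborel {0<..} (\<lambda>y. of_real (1 / y) * ?\<psi> y)"
    by (rule set_integrable_schwartz_odd_weight[OF \<phi>, where P = 0 and Q = 1]) auto
  have "set_integrable lborel {0<..} (\<lambda>x. ?G x - fourier \<phi> (- x))"
    using G H by (rule set_integral_diff)
  moreover have fold: "?F x + ?F (- x) = ?G x - fourier \<phi> (- x)" if "x \<in> {0<..}" for x
    using that by (intro bose_fold) simp
  ultimately have "set_integrable lborel {0<..} (\<lambda>x. ?F x + ?F (- x))"
    by (subst set_integrable_cong[OF refl refl fold])
  from tendsto_principal_value[OF set_integrable_bose_fourier this]
  have "((\<lambda>\<epsilon>. LINT x:{x. \<epsilon> < \<bar>x\<bar>}|lborel. ?F x) \<longlongrightarrow> (LINT x:{0<..}|lborel. ?F x + ?F (- x))) (at_right 0)" .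
  also have "(LINT x:{0<..}|lborel. ?F x + ?F (- x)) = (LINT x:{0<..}|lborel. ?G x - fourier \<phi> (- x))"
    using fold by (intro set_lebesgue_integral_cong) auto
  also have "\<dots> = (LINT x:{0<..}|lborel. ?G x) - (LINT x:{0<..}|lborel. fourier \<phi> (- x))"
    using G H by (rule set_integral_diff)
  also have "(LINT x:{0<..}|lborel. ?G x)
      = - 2 * \<i> * (LINT y:{0<..}|lborel. of_real (1 / 2 * ?k y - 1 / 2 * (1 / y)) * ?\<psi> y)"
  proof -
    have "pi / (2 * \<beta>) * (cosh (pi * y / \<beta>) / sinh (pi * y / \<beta>)) - 1 / (2 * y) = 1 / 2 * ?k y - 1 / 2 * (1 / y)"
      for y by simp
    then show ?thesis using set_integral_bose_fourier_odd[OF \<phi> b] by (simp only:)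
  qed
  also have "(LINT y:{0<..}|lborel. of_real (1 / 2 * ?k y - 1 / 2 * (1 / y)) * ?\<psi> y)
      = (LINT y:{0<..}|lborel. (1 / 2) * (of_real (?k y) * ?\<psi> y) - (1 / 2) * (of_real (1 / y) * ?\<psi> y))"
    unfolding of_real_diff of_real_mult[of "1 / 2"] left_diff_distrib mult.assoc by simp
  also have "\<dots> = 1 / 2 * (LINT y:{0<..}|lborel. of_real (?k y) * ?\<psi> y)
      - 1 / 2 * (LINT y:{0<..}|lborel. of_real (1 / y) * ?\<psi> y)"
    using set_integrable_coth_schwartz_odd R
    by (subst set_integral_diff) (simp_all only: set_integral_mult_right set_integrable_mult_right)
  finally show ?thesis
    unfolding set_integral_fourier_Ioi[OF \<phi>] by (simp add: algebra_simps)
qed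

end

section \<open>Finite parts and the passage from Bose to Fermi\<close>

text \<open>When the limit exists there is nothing to discard: no powers and a zero logarithmic
  coefficient.\<close>

lemma fp_pairing_limitI:
  assumes "((\<lambda>\<epsilon>. LINT x:{x. \<epsilon> < \<bar>x\<bar>}|lborel. f x * \<phi> x) \<longlongrightarrow> c) (at_right 0)"
  shows "fp_pairing f \<phi> c"
  unfolding fp_pairing_def has_finite_part_def
  by (rule exI[of _ "{}"], rule exI, rule exI[of _ 0]) (use assms in simp)

text \<open>The identity is asked for only off 0, a point that every cut-off excludes. For the Fermi
  function it fails at 0: the left side is 1/2, while division by zero makes the right side
  0.\<close>

lemma tendsto_pairing_diff:
  fixes f f1 f2 u :: "real \<Rightarrow> complex"
  assumes eq: "\<And>x. x \<noteq> 0 \<Longrightarrow> f x = f1 x - 2 * f2 x"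
    and int: "\<And>\<epsilon>. \<epsilon> > 0 \<Longrightarrow> set_integrable lborel {x. \<epsilon> < \<bar>x\<bar>} (\<lambda>x. f1 x * u x)"
      "\<And>\<epsilon>. \<epsilon> > 0 \<Longrightarrow> set_integrable lborel {x. \<epsilon> < \<bar>x\<bar>} (\<lambda>x. f2 x * u x)"
    and lim: "((\<lambda>\<epsilon>. LINT x:{x. \<epsilon> < \<bar>x\<bar>}|lborel. f1 x * u x) \<longlongrightarrow> c1) (at_right 0)"
      "((\<lambda>\<epsilon>. LINT x:{x. \<epsilon> < \<bar>x\<bar>}|lborel. f2 x * u x) \<longlongrightarrow> c2) (at_right 0)"
  shows "((\<lambda>\<epsilon>. LINT x:{x. \<epsilon> < \<bar>x\<bar>}|lborel. f x * u x) \<longlongrightarrow> c1 - 2 * c2) (at_right 0)"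
proof (rule Lim_transform_eventually)
  show "((\<lambda>\<epsilon>. (LINT x:{x. \<epsilon> < \<bar>x\<bar>}|lborel. f1 x * u x) - 2 * (LINT x:{x. \<epsilon> < \<bar>x\<bar>}|lborel. f2 x * u x))
      \<longlongrightarrow> c1 - 2 * c2) (at_right 0)"
    by (intro tendsto_intros lim)
  have "(LINT x:{x. \<epsilon> < \<bar>x\<bar>}|lborel. f1 x * u x) - 2 * (LINT x:{x. \<epsilon> < \<bar>x\<bar>}|lborel. f2 x * u x)
      = (LINT x:{x. \<epsilon> < \<bar>x\<bar>}|lborel. f x * u x)" if "\<epsilon> > 0" for \<epsilon>
  proof -
    have "(LINT x:{x. \<epsilon> < \<bar>x\<bar>}|lborel. f x * u x) = (LINT x:{x. \<epsilon> < \<bar>x\<bar>}|lborel. f1 x * u x - 2 * (f2 x * u x))"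
      using that by (intro set_lebesgue_integral_cong) (auto simp: eq left_diff_distrib)
    also have "\<dots> = (LINT x:{x. \<epsilon> < \<bar>x\<bar>}|lborel. f1 x * u x) - (LINT x:{x. \<epsilon> < \<bar>x\<bar>}|lborel. 2 * (f2 x * u x))"
      using int[OF that] by (intro set_integral_diff set_integrable_mult_right)
    finally show ?thesis by simp
  qed
  then show "eventually (\<lambda>\<epsilon>. (LINT x:{x. \<epsilon> < \<bar>x\<bar>}|lborel. f1 x * u x) - 2 * (LINT x:{x. \<epsilon> < \<bar>x\<bar>}|lborel. f2 x * u x)
      = (LINT x:{x. \<epsilon> < \<bar>x\<bar>}|lborel. f x * u x)) (at_right 0)"
    by (auto simp: eventually_at_filter)
qed

text \<open>With e = exp(\<beta>x) this is the partial fraction 2/(e^2 - 1) = 1/(e - 1) - 1/(e +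
  1).\<close>

lemma fermi_eq_bose_diff:
  assumes "\<beta> \<noteq> 0" "x \<noteq> 0"
  shows "1 / of_real (exp (\<beta> * x) + 1) = bose \<beta> x - 2 * bose (2 * \<beta>) x"
proof -
  define e where "e = exp (\<beta> * x)"
  have e: "e > 0" "e \<noteq> 1" using assms by (auto simp: e_def)
  have "exp (2 * \<beta> * x) = e * e" by (simp add: e_def mult_exp_exp)
  then have "bose \<beta> x - 2 * bose (2 * \<beta>) x = of_real (1 / (e - 1) - 2 / (e * e - 1))"
    by (simp add: bose_def e_def)
  also have "e * e - 1 = (e - 1) * (e + 1)" by (simp add: algebra_simps)
  also have "1 / (e - 1) - 2 / ((e - 1) * (e + 1)) = 1 / (e + 1)"
    using e by (simp add: divide_simps)
  finally show ?thesis by (simp add: e_def)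
qed

text \<open>Passing to 2\<beta> halves both the argument and the prefactor of coth; the coefficient
  2 restores the prefactor, leaving i pi/\<beta> times coth z - coth 2z.\<close>

lemma cosech_eq_coth_diff:
  fixes \<beta> x :: real
  assumes "\<beta> \<noteq> 0" "x \<noteq> 0"
  shows "\<i> * of_real pi / of_real (\<beta> * sinh (pi * x / \<beta>)) = bose_transform \<beta> x - 2 * bose_transform (2 * \<beta>) x"
proof -
  define z where "z = pi * x / (2 * \<beta>)"
  have z: "z \<noteq> 0" "pi * x / \<beta> = 2 * z" using assms by (auto simp: z_def)
  have s: "sinh z \<noteq> 0" using z by simp
  have "2 * sinh z * cosh z \<noteq> 0" using s by simp
  then have half: "cosh z / sinh z - cosh (2 * z) / sinh (2 * z) = 1 / sinh (2 * z)"
    using s cosh_square_eq[of z] unfolding sinh_double cosh_double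
    by (simp add: divide_simps power2_eq_square)
  have "bose_transform \<beta> x - 2 * bose_transform (2 * \<beta>) x
      = \<i> * of_real (pi / \<beta> * (cosh z / sinh z - cosh (2 * z) / sinh (2 * z)))"
    unfolding bose_transform_eq z z_def[symmetric] by (simp add: algebra_simps)
  also have "\<dots> = \<i> * of_real pi / of_real (\<beta> * sinh (pi * x / \<beta>))"
    unfolding half z by simp
  finally show ?thesis by simp
qed

theorem theorem3p6:
  fixes \<beta> :: real and \<phi> :: "real \<Rightarrow> complex"
  assumes "\<beta> > 0" and "schwartz \<phi>"
  shows "(\<exists>c. fp_pairing (\<lambda>x. \<i> * of_real pi / of_real (\<beta> * sinh (pi * x / \<beta>))) \<phi> c \<and>
              fp_pairing (\<lambda>x. 1 / of_real (exp (\<beta> * x) + 1)) (fourier \<phi>)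
                (of_real pi * \<phi> 0 + c))
       \<and> (\<exists>c. fp_pairing (\<lambda>x. of_real pi / (\<i> * of_real \<beta>) * of_real (cosh (pi * x / \<beta>) / sinh (pi * x / \<beta>))) \<phi> c \<and>
              fp_pairing (\<lambda>x. 1 / of_real (exp (\<beta> * x) - 1)) (fourier \<phi>)
                (- of_real pi * \<phi> 0 + c))"
proof (rule conjI)
  have b: "\<beta> \<noteq> 0" "2 * \<beta> > 0" using assms(1) by auto
  \<comment> \<open>\<open>c \<gamma>\<close> is the principal value of
    \<open>bose_transform \<gamma>\<close> paired with \<phi>. It is defined for every \<gamma> so
    that the Fermi witness can combine \<gamma> = \<beta> and \<gamma> = 2\<beta>.\<close>
  define c where "c \<gamma> = - \<i> * (LINT y:{0<..}|lborel.
    of_real (pi / \<gamma> * (cosh (pi * y / \<gamma>) / sinh (pi * y / \<gamma>))) * (\<phi> y - \<phi> (- y)))" for \<gamma>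
  have h: "((\<lambda>\<epsilon>. LINT x:{x. \<epsilon> < \<bar>x\<bar>}|lborel. bose_transform \<gamma> x * \<phi> x) \<longlongrightarrow> c \<gamma>) (at_right 0)"
    and f: "((\<lambda>\<epsilon>. LINT x:{x. \<epsilon> < \<bar>x\<bar>}|lborel. bose \<gamma> x * fourier \<phi> x) \<longlongrightarrow> - of_real pi * \<phi> 0 + c \<gamma>) (at_right 0)"
    if "\<gamma> > 0" for \<gamma>
    unfolding c_def by (rule tendsto_bose_transform[OF assms(2) that] tendsto_bose_fourier[OF assms(2) that])+
  show "\<exists>c. fp_pairing (\<lambda>x. of_real pi / (\<i> * of_real \<beta>) * of_real (cosh (pi * x / \<beta>) / sinh (pi * x / \<beta>))) \<phi> c \<and>
              fp_pairing (\<lambda>x. 1 / of_real (exp (\<beta> * x) - 1)) (fourier \<phi>) (- of_real pi * \<phi> 0 + c)"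
    using fp_pairing_limitI[OF h[OF assms(1)]] fp_pairing_limitI[OF f[OF assms(1)]]
    unfolding bose_def[abs_def] bose_transform_def[abs_def] by blast
  have "fp_pairing (\<lambda>x. \<i> * of_real pi / of_real (\<beta> * sinh (pi * x / \<beta>))) \<phi> (c \<beta> - 2 * c (2 * \<beta>))"
    using assms b by (intro fp_pairing_limitI tendsto_pairing_diff[OF cosech_eq_coth_diff] h
        set_integrable_bose_transform) auto
  moreover have "fp_pairing (\<lambda>x. 1 / of_real (exp (\<beta> * x) + 1)) (fourier \<phi>)
      ((- of_real pi * \<phi> 0 + c \<beta>) - 2 * (- of_real pi * \<phi> 0 + c (2 * \<beta>)))"
    using assms b by (intro fp_pairing_limitI tendsto_pairing_diff[OF fermi_eq_bose_diff] f
        set_integrable_bose_fourier) auto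
  \<comment> \<open>Here the delta changes sign: -pi - 2(-pi) = pi.\<close>
  moreover have "(- of_real pi * \<phi> 0 + c \<beta>) - 2 * (- of_real pi * \<phi> 0 + c (2 * \<beta>))
      = of_real pi * \<phi> 0 + (c \<beta> - 2 * c (2 * \<beta>))"
    by (simp add: algebra_simps)
  ultimately show "\<exists>c. fp_pairing (\<lambda>x. \<i> * of_real pi / of_real (\<beta> * sinh (pi * x / \<beta>))) \<phi> c \<and>
              fp_pairing (\<lambda>x. 1 / of_real (exp (\<beta> * x) + 1)) (fourier \<phi>) (of_real pi * \<phi> 0 + c)"
    by metis
qed

end
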